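(* Let $1\le k\le n$, $x=(x',x'')\in\mathbb{R}^k\times\mathbb{R}^{n-k}$, $R>0$, $1<p<\infty$, $\alpha,\beta\in\mathbb{R}$, and let $\Omega_R=\{x\in\mathbb{R}^n:0<|x'|_k<R\}$. Write $L(x)=\log\frac{R}{|x'|_k}$. (i) If $(k-\alpha-p)(\beta+p)\ge0$, then for all complex-valued $f\in C_0^\infty(\Omega_R)$, $$\left|\frac{\beta+p}{p}\right|^p\int_{\Omega_R}\frac{|f|^p}{|x'|_k^{\alpha+p}L^{\beta+p+1}}dx\le\int_{\Omega_R}\frac{|x'\cdot\nabla_kf|^p}{|x'|_k^{\alpha+p}L^{\beta+1}}dx,$$ and when $\beta\ne-p$ the constant $\left|\frac{\beta+p}{p}\right|^p$ is sharp (it cannot be replaced by any larger constant). (ii) For all complex-valued $f\in C_0^\infty(\Omega_R)$, $$\left|\frac{\beta+p}{p}\right|^p\int_{\Omega_R}\frac{|f|^p}{|x'|_k^{\alpha+p}L^{\beta+p+1}}dx=\int_{\Omega_R}\frac{|x'\cdot\nabla_kf|^p}{|x'|_k^{\alpha+p}L^{\beta+1}}dx-(k-\alpha-p)\frac{\beta+p}{p}\left|\frac{\beta+p}{p}\right|^{p-2}\int_{\Omega_R}\frac{|f|^p}{|x'|_k^{\alpha+p}L^{\beta+p}}dx-\int_{\Omega_R}C_p(\xi,\eta)\,dx,$$ where $\xi=\dfrac{x'\cdot\nabla_kf}{|x'|_k^{(\alpha+p)/p}L^{(\beta+1)/p}}$ and $\eta=\xi+\dfrac{\beta+p}{p}\,\dfrac{f}{|x'|_k^{(\alpha+p)/p}L^{(\beta+p+1)/p}}$.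 (iii) If $k=\alpha+p$ and $p\ge2$, then $\int_{\Omega_R}C_p(\xi,\eta)dx$ vanishes only if $f=L^{(\beta+p)/p}\varphi(x'/|x'|_k,x'')$ for some function $\varphi$, which for $f\in C_0^\infty(\Omega_R)$ forces $f=0$; hence the inequality in (i) is strict for every nonzero $f\in C_0^\infty(\Omega_R)$ (the sharp constant is not attained).
   Context: $|\cdot|_k$ is the Euclidean norm on $\mathbb{R}^k$, $\nabla_k=(\partial_{x_1},\dots,\partial_{x_k})$, $x'\cdot\nabla_kf=\sum_{j=1}^kx_j\partial_{x_j}f$. For complex $\xi,\eta$ and $1<p<\infty$, $C_p(\xi,\eta):=|\xi|^p-|\xi-\eta|^p-p|\xi-\eta|^{p-2}\operatorname{Re}((\xi-\eta)\overline{\eta})$, with the last term $0$ when $\xi=\eta$. *)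

theory Defs
  imports "HOL-Analysis.Analysis"
begin

text \<open>R^n is real^'n; the first-block coordinates x' are those indexed by a nonempty
  set K of indices (k = card K); x'' are the remaining coordinates.\<close>

definition normK :: "'n::finite set \<Rightarrow> real^'n \<Rightarrow> real" where
  "normK K x = sqrt (\<Sum>i\<in>K. (x$i)^2)"

definition OmegaR :: "'n::finite set \<Rightarrow> real \<Rightarrow> (real^'n) set" where
  "OmegaR K R = {x. 0 < normK K x \<and> normK K x < R}"

definition Lg :: "'n::finite set \<Rightarrow> real \<Rightarrow> real^'n \<Rightarrow> real" where
  "Lg K R x = ln (R / normK K x)"

definition pderivc :: "(real^'n::finite \<Rightarrow> complex) \<Rightarrow> 'n \<Rightarrow> real^'n \<Rightarrow> complex" where
  "pderivc f j x = frechet_derivative f (at x) (axis j 1)"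

definition xgrad :: "'n::finite set \<Rightarrow> (real^'n \<Rightarrow> complex) \<Rightarrow> real^'n \<Rightarrow> complex" where
  "xgrad K f x = (\<Sum>j\<in>K. complex_of_real (x$j) * pderivc f j x)"

definition smooth_fun :: "(real^'n::finite \<Rightarrow> complex) \<Rightarrow> bool" where
  "smooth_fun f \<longleftrightarrow> (\<exists>F. f \<in> F \<and>
     (\<forall>g\<in>F. g differentiable_on UNIV \<and> (\<forall>j. pderivc g j \<in> F)))"

text \<open>C_0^infinity(Omega_R): smooth with compact support contained in Omega_R
  (extended by zero outside Omega_R).\<close>
definition test_fun :: "'n::finite set \<Rightarrow> real \<Rightarrow> (real^'n \<Rightarrow> complex) \<Rightarrow> bool" where
  "test_fun K R f \<longleftrightarrow> smooth_fun f \<and> compact (closure {x. f x \<noteq> 0})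
      \<and> closure {x. f x \<noteq> 0} \<subseteq> OmegaR K R"

definition Cp :: "real \<Rightarrow> complex \<Rightarrow> complex \<Rightarrow> real" where
  "Cp p \<xi> \<eta> = (if \<xi> = \<eta> then cmod \<xi> powr p
     else cmod \<xi> powr p - cmod (\<xi> - \<eta>) powr p
          - p * cmod (\<xi> - \<eta>) powr (p - 2) * Re ((\<xi> - \<eta>) * cnj \<eta>))"

definition Ifw :: "'n::finite set \<Rightarrow> real \<Rightarrow> real \<Rightarrow> real \<Rightarrow> real \<Rightarrow> (real^'n \<Rightarrow> complex) \<Rightarrow> real" where
  "Ifw K R p a b f = (\<integral>x. cmod (f x) powr p / (normK K x powr a * Lg K R x powr b)
                      \<partial>(lebesgue_on (OmegaR K R)))"

definition xi_fun :: "'n::finite set \<Rightarrow> real \<Rightarrow> real \<Rightarrow> real \<Rightarrow> real \<Rightarrow> (real^'n \<Rightarrow> complex) \<Rightarrow> real^'n \<Rightarrow> complex" where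
  "xi_fun K R p \<alpha> \<beta> f x = xgrad K f x /
     complex_of_real (normK K x powr ((\<alpha> + p) / p) * Lg K R x powr ((\<beta> + 1) / p))"

definition eta_fun :: "'n::finite set \<Rightarrow> real \<Rightarrow> real \<Rightarrow> real \<Rightarrow> real \<Rightarrow> (real^'n \<Rightarrow> complex) \<Rightarrow> real^'n \<Rightarrow> complex" where
  "eta_fun K R p \<alpha> \<beta> f x = xi_fun K R p \<alpha> \<beta> f x
     + complex_of_real ((\<beta> + p) / p) * f x /
       complex_of_real (normK K x powr ((\<alpha> + p) / p) * Lg K R x powr ((\<beta> + p + 1) / p))"

end

theory Submission
  imports Defs
begin

text \<open>Write \<open>b = (\<beta>+p)/p\<close>. Expanding \<open>C\<^sub>p(\<xi>,\<eta>)\<close> with \<open>\<xi> - \<eta> = -b f / (\<dots>)\<close> gives \<open>|\<xi>|^p\<close>, a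
  multiple of \<open>|f|^p\<close>, and a cross term which is \<open>b |b|^(p-2)\<close> times the derivative of \<open>|f|^p\<close> along the
  Euler field \<open>x' \<cdot> \<nabla>\<^sub>k\<close>, against the weight \<open>|x'|^(-\<alpha>-p) L^(-\<beta>-p)\<close>. Integrating that term by parts
  is the identity. The inequality follows because \<open>C\<^sub>p \<ge> 0\<close>, by convexity of \<open>|\<cdot>|^p\<close>, and \<open>C\<^sub>p\<close> vanishes only
  for \<open>\<eta> = 0\<close>; then \<open>f / L^b\<close> is constant along the rays in \<open>x'\<close>, so a compactly supported \<open>f\<close> is zero.
  For sharpness, \<open>L^b\<close> is cut off smoothly to \<open>-N < ln L < 0\<close>: the mass of the plateau grows
  linearly in \<open>N\<close>, while the two transition layers contribute a bounded amount.\<close>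

section \<open>The functional \<open>C\<^sub>p\<close> and powers of the modulus\<close>

text \<open>For 1 < p < 2 the map |z|^p is C^1 but not C^2 at 0, so the integration by parts is
  proved for compactly supported C^1 functions. The weights are meaningful only on
  \<open>OmegaR K R\<close>, and both x' = 0 and |x'| = R lie outside it; since f has compact
  support inside, every integrand can be extended by zero. The coefficient k - alpha - p is the
  divergence k of the Euler field plus the degree -alpha-p of |x'|^(-alpha-p). The power L^b is
  singled out because it solves eta = 0. Near |x'| = R its two energy densities in the variable ln L
  are comparable to constants, so it has infinite energy and must be truncated. The truncations live
  where L <= 1; there powers of |x'| lie between positive constants, so alpha and k do not affect
  the constant. The cut-off in x'' costs nothing, since only x' is differentiated. As
  \<open>smooth_fun\<close> asks for a family closed under partial derivatives, cut-offs are handled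
  through algebras of functions whose generators have derivatives inside the algebra.\<close>

lemma powr_tangent_strict:
  fixes u p :: real
  assumes "1 < p" "0 \<le> u" "u \<noteq> 1"
  shows "1 + p * (u - 1) < u powr p"
proof (cases "u = 0")
  case True
  then show ?thesis using assms by simp
next
  case False
  then have u: "u > 0" using assms by simp
  have der: "\<And>x. x > 0 \<Longrightarrow> ((\<lambda>x. x powr p) has_real_derivative p * x powr (p - 1)) (at x)"
    by (auto intro!: derivative_eq_intros simp: powr_diff)
  consider "u < 1" | "u > 1" using assms by linarith
  then show ?thesis
  proof cases
    case 1
    obtain z where z: "u < z" "z < 1" "1 powr p - u powr p = (1 - u) * (p * z powr (p - 1))"
      using MVT2[of u 1 "\<lambda>x. x powr p" "\<lambda>x. p * x powr (p - 1)"] 1 u der by force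
    have "z powr (p - 1) < 1 powr (p - 1)"
      using z u assms by (intro powr_less_mono2) auto
    then have "(1 - u) * (p * z powr (p - 1)) < (1 - u) * (p * 1)"
      using 1 assms by (intro mult_strict_left_mono) auto
    then show ?thesis using z by (simp add: algebra_simps)
  next
    case 2
    obtain z where z: "1 < z" "z < u" "u powr p - 1 powr p = (u - 1) * (p * z powr (p - 1))"
      using MVT2[of 1 u "\<lambda>x. x powr p" "\<lambda>x. p * x powr (p - 1)"] 2 u der by force
    have "1 powr (p - 1) < z powr (p - 1)"
      using z u assms by (intro powr_less_mono2) auto
    then have "(u - 1) * (p * 1) < (u - 1) * (p * z powr (p - 1))"
      using 2 assms by (intro mult_strict_left_mono) auto
    then show ?thesis using z by (simp add: algebra_simps)
  qed
qed

text \<open>By homogeneity: dividing by \<open>y powr p\<close> leaves the tangent to t^p at 1,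
  evaluated at x / y.\<close>

lemma powr_tangent_ge:
  fixes x y p :: real
  assumes "1 < p" "0 \<le> x" "0 < y"
  shows "y powr p + p * y powr (p - 1) * (x - y) \<le> x powr p"
    and "x \<noteq> y \<Longrightarrow> y powr p + p * y powr (p - 1) * (x - y) < x powr p"
proof -
  have eq: "y powr p + p * y powr (p - 1) * (x - y) = y powr p * (1 + p * (x / y - 1))"
    using assms by (simp add: powr_diff field_simps)
  have eq2: "x powr p = y powr p * (x / y) powr p"
    using assms by (simp add: powr_divide)
  show lt: "x \<noteq> y \<Longrightarrow> y powr p + p * y powr (p - 1) * (x - y) < x powr p"
    unfolding eq eq2 using assms powr_tangent_strict[of p "x / y"]
    by (intro mult_strict_left_mono) auto
  show "y powr p + p * y powr (p - 1) * (x - y) \<le> x powr p"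
    using lt assms by (cases "x = y") auto
qed

text \<open>With zeta = xi - eta and y = |zeta|, \<open>Cp\<close> splits into two nonnegative
  pieces: the gap between t^p and its tangent at y, taken at t = |xi|, and a multiple of the
  Cauchy-Schwarz defect |zeta| |xi| - Re(zeta conj xi).\<close>

lemma Cp_nonneg_eq_0:
  fixes \<xi> \<eta> :: complex
  assumes p: "1 < p"
  shows Cp_nonneg: "0 \<le> Cp p \<xi> \<eta>" and Cp_eq_0_imp: "Cp p \<xi> \<eta> = 0 \<Longrightarrow> \<eta> = 0"
proof -
  have "0 \<le> Cp p \<xi> \<eta> \<and> (Cp p \<xi> \<eta> = 0 \<longrightarrow> \<eta> = 0)"
  proof (cases "\<xi> = \<eta>")
    case True
    then show ?thesis by (auto simp: Cp_def)
  next
    case False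
    define \<zeta> where "\<zeta> = \<xi> - \<eta>"
    define y where "y = cmod \<zeta>"
    have y: "y > 0" using False by (simp add: y_def \<zeta>_def)
    have yy: "y powr (p - 2) * (y * y) = y powr p" "y powr (p - 2) * y = y powr (p - 1)"
      using y by (simp_all add: powr_diff power2_eq_square)
    have Re_eq: "Re (\<zeta> * cnj \<eta>) = Re (\<zeta> * cnj \<xi>) - y * y"
    proof -
      have "y * y = (Re \<zeta>)\<^sup>2 + (Im \<zeta>)\<^sup>2"
        by (simp add: y_def cmod_power2 flip: power2_eq_square)
      moreover have "Re \<eta> = Re \<xi> - Re \<zeta>" "Im \<eta> = Im \<xi> - Im \<zeta>" by (simp_all add: \<zeta>_def)
      ultimately show ?thesis by (simp add: right_diff_distrib power2_eq_square)
    qed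
    have Re_le: "Re (\<zeta> * cnj \<xi>) \<le> y * cmod \<xi>"
      using complex_Re_le_cmod[of "\<zeta> * cnj \<xi>"] by (simp add: norm_mult y_def)
    have Cp_eq: "Cp p \<xi> \<eta> = (cmod \<xi> powr p - (y powr p + p * y powr (p - 1) * (cmod \<xi> - y)))
                   + p * y powr (p - 2) * (y * cmod \<xi> - Re (\<zeta> * cnj \<xi>))"
    proof -
      have "Cp p \<xi> \<eta> = cmod \<xi> powr p - y powr p - p * y powr (p - 2) * (Re (\<zeta> * cnj \<xi>) - y * y)"
        using False Re_eq by (simp add: Cp_def y_def \<zeta>_def)
      then show ?thesis unfolding yy(2)[symmetric] by (simp add: algebra_simps)
    qed
    have t1: "0 \<le> cmod \<xi> powr p - (y powr p + p * y powr (p - 1) * (cmod \<xi> - y))"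
      using powr_tangent_ge(1)[OF p _ y, of "cmod \<xi>"] by simp
    have t2: "0 \<le> p * y powr (p - 2) * (y * cmod \<xi> - Re (\<zeta> * cnj \<xi>))"
      using Re_le p by simp
    have "\<eta> = 0" if "Cp p \<xi> \<eta> = 0"
    proof -
      have e1: "cmod \<xi> powr p - (y powr p + p * y powr (p - 1) * (cmod \<xi> - y)) = 0"
        and e2: "p * y powr (p - 2) * (y * cmod \<xi> - Re (\<zeta> * cnj \<xi>)) = 0"
        using t1 t2 that Cp_eq by linarith+
      have "cmod \<xi> = y" using powr_tangent_ge(2)[OF p _ y, of "cmod \<xi>"] e1 by force
      moreover have "y * cmod \<xi> = Re (\<zeta> * cnj \<xi>)" using e2 p y by simp
      \<comment> \<open>Equality in Cauchy-Schwarz makes the two vectors parallel with the same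
        direction; having equal length, they coincide.\<close>
      ultimately have "inner \<zeta> \<xi> = norm \<zeta> * norm \<xi>"
        by (simp add: y_def inner_complex_def)
      then have "\<zeta> = \<xi>" using norm_cauchy_schwarz_eq[of \<zeta> \<xi>] \<open>cmod \<xi> = y\<close> y by (auto simp: y_def)
      then show ?thesis by (simp add: \<zeta>_def)
    qed
    then show ?thesis using t1 t2 Cp_eq by linarith
  qed
  then show "0 \<le> Cp p \<xi> \<eta>" "Cp p \<xi> \<eta> = 0 \<Longrightarrow> \<eta> = 0" by auto
qed

text \<open>This map is 1/p times the gradient of |z|^p. For p < 2 its first factor is unbounded
  near 0, but the product has modulus |z|^(p-1), which tends to 0.\<close>

lemma continuous_on_powr_times:
  assumes "1 < p"
  shows "continuous_on UNIV (\<lambda>z::complex. complex_of_real (cmod z powr (p - 2)) * z)"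
proof -
  have "isCont (\<lambda>z::complex. complex_of_real (cmod z powr (p - 2)) * z) z" for z
  proof (cases "z = 0")
    case True
    have "((\<lambda>z::complex. cmod z powr (p - 1)) \<longlongrightarrow> cmod 0 powr (p - 1)) (at 0)"
      using assms by (intro tendsto_intros) auto
    then have lim: "((\<lambda>z::complex. cmod z powr (p - 1)) \<longlongrightarrow> 0) (at 0)" by simp
    have "((\<lambda>z::complex. complex_of_real (cmod z powr (p - 2)) * z) \<longlongrightarrow> 0) (at 0)"
    proof (rule Lim_null_comparison[OF _ lim])
      show "\<forall>\<^sub>F z in at 0. cmod (complex_of_real (cmod z powr (p - 2)) * z) \<le> cmod z powr (p - 1)"
        by (auto simp: eventually_at_filter norm_mult norm_divide powr_diff power2_eq_square)
    qed
    then show ?thesis using True by (simp add: isCont_def)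
  next
    case False
    then show ?thesis by (intro continuous_intros) auto
  qed
  then show ?thesis by (simp add: continuous_on_eq_continuous_at)
qed

text \<open>At 0 the difference quotient is |z|^(p-1), which tends to 0 because p > 1. The factor
  |z|^(p-2) z is kept together since only the product extends continuously to 0.\<close>

lemma has_derivative_cmod_powr:
  assumes "1 < p"
  shows "((\<lambda>z. cmod z powr p) has_derivative
           (\<lambda>h. p * Re (complex_of_real (cmod z powr (p - 2)) * z * cnj h))) (at z)"
proof (cases "z = 0")
  case True
  have "((\<lambda>z::complex. cmod z powr (p - 1)) \<longlongrightarrow> cmod 0 powr (p - 1)) (at 0)"
    using assms by (intro tendsto_intros) auto
  then have lim: "((\<lambda>z::complex. cmod z powr (p - 1)) \<longlongrightarrow> 0) (at 0)" by simp
  have "((\<lambda>y. norm (cmod y powr p) / norm y) \<longlongrightarrow> 0) (at (0::complex))"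
    by (rule Lim_transform_eventually[OF lim]) (auto simp: eventually_at_filter powr_diff)
  then show ?thesis using True
    by (simp add: has_derivative_at_within tendsto_norm_zero_iff divide_inverse mult.commute)
next
  case False
  have n: "(norm has_derivative (\<lambda>h. h \<bullet> sgn z)) (at z)"
    using has_derivative_norm[OF False] .
  have "((\<lambda>x. x powr p) has_real_derivative p * cmod z powr (p - 1)) (at (cmod z))"
    using False by (auto intro!: derivative_eq_intros simp: powr_diff)
  then have "((\<lambda>x. x powr p) has_derivative (*) (p * cmod z powr (p - 1))) (at (cmod z))"
    by (simp add: has_field_derivative_def)
  from has_derivative_compose[OF n this]
  have "((\<lambda>z. cmod z powr p) has_derivative (\<lambda>h. p * cmod z powr (p - 1) * (h \<bullet> sgn z))) (at z)"
    by simp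
  moreover have "p * cmod z powr (p - 1) * (h \<bullet> sgn z)
      = p * Re (complex_of_real (cmod z powr (p - 2)) * z * cnj h)" for h
    using False
    by (simp add: powr_diff power2_eq_square inner_complex_def sgn_div_norm field_simps)
  ultimately show ?thesis by simp
qed

lemma Cp_expand:
  fixes e f :: complex and b s s' :: real
  assumes p: "1 < p" and s: "s > 0" and s': "s' > 0"
  shows "Cp p (e / of_real s) (e / of_real s + of_real b * f / of_real s')
    = cmod e powr p / s powr p + (p - 1) * \<bar>b\<bar> powr p * (cmod f powr p / s' powr p)
      + b * \<bar>b\<bar> powr (p - 2) * (p * Re (of_real (cmod f powr (p - 2)) * f * cnj e) / (s' powr (p - 1) * s))"
\<comment> \<open>Here xi = eta, the branch of \<open>Cp\<close> that returns |xi|^p; the other two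
  terms vanish because \<open>0 powr x = 0\<close> for every x.\<close>
proof (cases "b = 0 \<or> f = 0")
  case True
  then show ?thesis using p s by (auto simp: Cp_def norm_divide powr_divide)
next
  case False
  define \<xi> where "\<xi> = e / of_real s"
  define v where "v = of_real b * f / of_real s'"
  define y where "y = cmod v"
  have v: "v \<noteq> 0" using False s' by (simp add: v_def)
  then have y: "y > 0" by (simp add: y_def)
  have yp: "y powr (p - 2) * (y * y) = y powr p"
    using y by (simp add: powr_diff power2_eq_square)
  have y_eq: "y = \<bar>b\<bar> * cmod f / s'" using s' by (simp add: y_def v_def norm_mult norm_divide)
  have R: "Re ((\<xi> - (\<xi> + v)) * cnj (\<xi> + v)) = - Re (v * cnj \<xi>) - y * y"
    using cmod_power2[of v] by (simp add: y_def power2_eq_square algebra_simps)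
  have "Cp p \<xi> (\<xi> + v) = cmod \<xi> powr p - y powr p - p * y powr (p - 2) * (- Re (v * cnj \<xi>) - y * y)"
    using v R by (simp add: Cp_def y_def)
  also have "\<dots> = cmod \<xi> powr p + (p - 1) * y powr p + p * (y powr (p - 2) * Re (v * cnj \<xi>))"
    unfolding yp[symmetric] by (simp add: algebra_simps)
  also have "y powr p = \<bar>b\<bar> powr p * (cmod f powr p / s' powr p)"
    using s' by (simp add: y_eq powr_divide powr_mult)
  also have "cmod \<xi> powr p = cmod e powr p / s powr p"
    using s by (simp add: \<xi>_def norm_divide powr_divide)
  also have "Re (v * cnj \<xi>) = b / (s' * s) * Re (f * cnj e)"
    unfolding v_def \<xi>_def using s s' by (simp add: field_simps)
  also have "y powr (p - 2) * (b / (s' * s) * Re (f * cnj e))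
      = b * \<bar>b\<bar> powr (p - 2) * (cmod f powr (p - 2) * Re (f * cnj e) / (s' powr (p - 1) * s))"
  proof -
    have "y powr (p - 2) = \<bar>b\<bar> powr (p - 2) * cmod f powr (p - 2) / s' powr (p - 2)"
      using s' by (simp add: y_eq powr_divide powr_mult)
    moreover have "s' powr (p - 1) = s' powr (p - 2) * s'"
      using s' by (simp add: powr_diff power2_eq_square)
    ultimately show ?thesis by (simp add: mult_ac)
  qed
  also have "cmod f powr (p - 2) * Re (f * cnj e) = Re (of_real (cmod f powr (p - 2)) * f * cnj e)"
    by (simp add: algebra_simps)
  finally show ?thesis unfolding \<xi>_def v_def by (simp only: mult_ac times_divide_eq_right)
qed

section \<open>Integration of compactly supported functions\<close>

text \<open>The open sets U and - S cover the space, and g is continuous on each.\<close>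

lemma continuous_on_UNIV_extend_zero:
  fixes g :: "'a::topological_space \<Rightarrow> 'b::real_normed_vector"
  assumes "open U" "closed S" "S \<subseteq> U" "continuous_on U g" "\<And>x. x \<notin> S \<Longrightarrow> g x = 0"
  shows "continuous_on UNIV g"
proof -
  have "continuous_on (- S) g"
    using assms(5) by (subst continuous_on_cong[where g = "\<lambda>_. 0"]) auto
  then have "continuous_on (U \<union> - S) g"
    using assms by (intro continuous_on_open_Un) auto
  moreover have "U \<union> - S = UNIV" using assms by auto
  ultimately show ?thesis by simp
qed

lemma integrable_lborel_compact_support:
  fixes g :: "'a::euclidean_space \<Rightarrow> real"
  assumes "continuous_on UNIV g" "compact S" "\<And>x. x \<notin> S \<Longrightarrow> g x = 0"
  shows "integrable lborel g"
proof -
  have "integrable lborel (\<lambda>x. indicator S x *\<^sub>R g x)"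
    using assms by (intro borel_integrable_compact) (auto intro: continuous_on_subset)
  moreover have "(\<lambda>x. indicator S x *\<^sub>R g x) = g"
    using assms(3) by (intro ext) (auto simp: indicator_def)
  ultimately show ?thesis by simp
qed

text \<open>Passes from \<open>lebesgue_on U\<close>, used in the theorem, to \<open>lborel\<close>
  on the whole space, where translations are available. The conditional discards whatever values g
  takes outside U.\<close>

lemma
  fixes g :: "'a::euclidean_space \<Rightarrow> real"
  assumes "open U" "compact S" "S \<subseteq> U" "continuous_on U g" "\<And>x. x \<in> U \<Longrightarrow> x \<notin> S \<Longrightarrow> g x = 0"
  shows integrable_lebesgue_on_compact_support: "integrable (lebesgue_on U) g"
    and integral_lebesgue_on_compact_support:
      "integral\<^sup>L (lebesgue_on U) g = (\<integral>x. (if x \<in> U then g x else 0) \<partial>lborel)"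
proof -
  let ?h = "\<lambda>x. if x \<in> U then g x else 0"
  have "continuous_on UNIV ?h"
  proof (rule continuous_on_UNIV_extend_zero[of U S])
    show "continuous_on U ?h" using assms(4) by (subst continuous_on_cong[where g = g]) auto
  qed (use assms in \<open>auto intro: compact_imp_closed\<close>)
  then have int: "integrable lborel ?h"
    using assms by (intro integrable_lborel_compact_support[of _ S]) auto
  then have int2: "integrable lebesgue ?h" by (simp add: integrable_completion)
  have eq: "(\<lambda>x. indicator U x *\<^sub>R g x) = ?h" by (auto simp: indicator_def)
  have U: "U \<inter> space lebesgue \<in> sets lebesgue" using assms(1) by auto
  show "integrable (lebesgue_on U) g"
    using int2 U by (subst integrable_restrict_space) (simp_all only: set_integrable_def eq)
  show "integral\<^sup>L (lebesgue_on U) g = integral\<^sup>L lborel ?h"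
    using int by (simp only: integral_restrict_space[OF U] eq integral_completion borel_measurable_integrable)
qed

text \<open>Translation invariance of Lebesgue measure makes the integral of every difference quotient
  vanish; the derivative is their dominated limit.\<close>

lemma integral_derivative_compact_support:
  fixes G :: "'a::euclidean_space \<Rightarrow> real"
  assumes der: "\<And>x. (G has_derivative G' x) (at x)"
    and cont: "continuous_on UNIV (\<lambda>x. G' x v)"
    and S: "compact S" "\<And>x. x \<notin> S \<Longrightarrow> G x = 0"
  shows "(\<integral>x. G' x v \<partial>lborel) = 0"
proof -
  have contG: "continuous_on UNIV G"
    using has_derivative_continuous[OF der] by (simp add: continuous_on_eq_continuous_at)
  have lin: "G' x (c *\<^sub>R v) = G' x v * c" for x c
    using linear_scale[OF has_derivative_linear[OF der]] by simp
  have G'0: "G' x v = 0" if "x \<notin> S" for x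
  proof -
    have "open (- S)" using S(1) compact_imp_closed by auto
    then have "((\<lambda>_. 0) has_derivative G' x) (at x)"
      by (rule has_derivative_transform_within_open[OF der]) (use that S(2) in auto)
    then have "G' x = (\<lambda>_. 0)" using has_derivative_unique[OF _ has_derivative_const] by blast
    then show ?thesis by simp
  qed
  obtain M where M: "\<And>x. \<bar>G' x v\<bar> \<le> M" "M \<ge> 0"
  proof -
    have "compact ((\<lambda>x. G' x v) ` S)"
      using S(1) cont by (intro compact_continuous_image) (auto intro: continuous_on_subset)
    then have "bounded ((\<lambda>x. G' x v) ` S)" by (rule compact_imp_bounded)
    then obtain M0 where "\<And>x. x \<in> S \<Longrightarrow> \<bar>G' x v\<bar> \<le> M0"
      by (auto simp: bounded_iff)
    then have "\<bar>G' x v\<bar> \<le> max M0 0" for x using G'0[of x] by (cases "x \<in> S") force+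
    then show ?thesis using that[of "max M0 0"] by auto
  qed
  have "bounded S" using S(1) compact_imp_bounded by blast
  then obtain B where B: "\<And>x. x \<in> S \<Longrightarrow> norm x \<le> B" by (auto simp: bounded_iff)
  \<comment> \<open>The n-th quotient evaluates G at x and at x + h v with 0 < h <= 1, so it
    vanishes once x is farther than norm v from the ball containing S.\<close>
  define D where "D = cball (0::'a) (B + norm v)"
  define q where "q n x = (G (x + inverse (real (Suc n)) *\<^sub>R v) - G x) * real (Suc n)" for n :: nat and x
  have intG: "integrable lborel G"
    using contG S by (intro integrable_lborel_compact_support) auto
  have intGt: "integrable lborel (\<lambda>x. G (x + c))" "(\<integral>x. G (x + c) \<partial>lborel) = integral\<^sup>L lborel G" for c
  proof -
    have "integrable (distr lborel borel ((+) c)) G" using intG by (simp add: lborel_distr_plus)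
    then show "integrable lborel (\<lambda>x. G (x + c))"
      using intG by (subst (asm) integrable_distr_eq) (auto simp: add.commute)
    have "integral\<^sup>L (distr lborel borel ((+) c)) G = (\<integral>x. G (c + x) \<partial>lborel)"
      using intG by (intro integral_distr) auto
    then show "(\<integral>x. G (x + c) \<partial>lborel) = integral\<^sup>L lborel G"
      by (simp add: lborel_distr_plus add.commute)
  qed
  have q0: "(\<integral>x. q n x \<partial>lborel) = 0" for n
    unfolding q_def using intG intGt by simp
  have bound: "norm (q n x) \<le> M * indicator D x" for n x
  proof -
    define h where "h = inverse (real (Suc n))"
    have h: "h > 0" "h \<le> 1" "h * real (Suc n) = 1"
      by (simp_all add: h_def inverse_le_1_iff del: of_nat_Suc)
    have "((\<lambda>t. G (x + t *\<^sub>R v)) has_real_derivative G' (x + t *\<^sub>R v) v) (at t)" for t :: real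
    proof -
      have "((\<lambda>t. x + t *\<^sub>R v) has_derivative (\<lambda>t. t *\<^sub>R v)) (at t)"
        by (auto intro!: derivative_eq_intros)
      from has_derivative_compose[OF this der] show ?thesis
        by (simp add: has_field_derivative_def lin)
    qed
    \<comment> \<open>The mean value theorem along the segment bounds all quotients by M, uniformly
      in n.\<close>
    then obtain z where "G (x + h *\<^sub>R v) - G (x + 0 *\<^sub>R v) = (h - 0) * G' (x + z *\<^sub>R v) v"
      using MVT2[of 0 h "\<lambda>t. G (x + t *\<^sub>R v)" "\<lambda>t. G' (x + t *\<^sub>R v) v"] h by blast
    then have "q n x = h * real (Suc n) * G' (x + z *\<^sub>R v) v"
      by (simp add: q_def h_def)
    then have 1: "norm (q n x) \<le> M" using M by (simp add: h del: of_nat_Suc)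
    have 2: "q n x = 0" if "x \<notin> D"
    proof -
      have n1: "norm x > B + norm v" using that by (simp add: D_def)
      then have "x \<notin> S" using B[of x] norm_ge_zero[of v] by linarith
      moreover have "x + h *\<^sub>R v \<notin> S"
      proof
        assume "x + h *\<^sub>R v \<in> S"
        then have "norm (x + h *\<^sub>R v) \<le> B" by (rule B)
        moreover have "norm x \<le> norm (x + h *\<^sub>R v) + norm (h *\<^sub>R v)"
          using norm_triangle_ineq4[of "x + h *\<^sub>R v" "h *\<^sub>R v"] by simp
        moreover have "norm (h *\<^sub>R v) \<le> norm v" using h by (simp add: mult_left_le_one_le)
        ultimately show False using n1 by linarith
      qed
      ultimately show ?thesis using S(2) by (simp add: q_def h_def)
    qed
    show ?thesis using 1 2 M(2) by (cases "x \<in> D") auto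
  qed
  have lim: "(\<lambda>n. q n x) \<longlonglongrightarrow> G' x v" for x
  proof -
    have "((\<lambda>t. x + t *\<^sub>R v) has_derivative (\<lambda>t. t *\<^sub>R v)) (at (0::real))"
      by (auto intro!: derivative_eq_intros)
    from has_derivative_compose[OF this, of G "G' x"] der[of x]
    have "((\<lambda>t. G (x + t *\<^sub>R v)) has_real_derivative G' x v) (at 0)"
      by (simp add: has_field_derivative_def lin)
    then have "((\<lambda>h. (G (x + h *\<^sub>R v) - G x) / h) \<longlongrightarrow> G' x v) (at 0)"
      by (simp add: DERIV_def)
    moreover have "filterlim (\<lambda>n. inverse (real (Suc n))) (at 0) sequentially"
      using LIMSEQ_inverse_real_of_nat by (simp add: filterlim_at del: of_nat_Suc)
    ultimately have "(\<lambda>n. (G (x + inverse (real (Suc n)) *\<^sub>R v) - G x) / inverse (real (Suc n))) \<longlonglongrightarrow> G' x v"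
      by (rule filterlim_compose)
    then show ?thesis by (simp add: q_def divide_inverse del: of_nat_Suc)
  qed
  have "(\<lambda>n. integral\<^sup>L lborel (q n)) \<longlonglongrightarrow> (\<integral>x. G' x v \<partial>lborel)"
  proof (rule integral_dominated_convergence)
    show "integrable lborel (\<lambda>x. M * indicator D x)"
      by (auto simp: D_def intro!: integrable_mult_right emeasure_compact_finite)
    show "(\<lambda>x. G' x v) \<in> borel_measurable lborel"
      using cont by (simp add: borel_measurable_continuous_onI)
    show "q n \<in> borel_measurable lborel" for n
      unfolding q_def using intG intGt by auto
  qed (use lim bound in auto)
  then show ?thesis using q0 by (simp add: LIMSEQ_const_iff)
qed

text \<open>The set where g is nonzero is open, and a nonempty open set is not negligible.\<close>

lemma open_AE_continuous_eq_0:
  fixes g :: "'a::euclidean_space \<Rightarrow> 'b::real_normed_vector"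
  assumes "open U" "continuous_on U g" "AE x in lebesgue_on U. g x = 0" "x \<in> U"
  shows "g x = 0"
proof (rule ccontr)
  assume "g x \<noteq> 0"
  let ?N = "{x \<in> U. g x \<noteq> 0}"
  have "?N = U \<inter> g -` (- {0})" by auto
  then have "open ?N"
    using assms(1,2) by (metis continuous_openin_preimage_gen open_Compl closed_singleton openin_open_eq)
  have "AE x in lebesgue. x \<in> U \<longrightarrow> g x = 0"
    using assms(1,3) by (subst (asm) AE_restrict_space_iff) auto
  then have "AE x in lebesgue. x \<notin> ?N" by auto
  then have "negligible ?N"
    using \<open>open ?N\<close> by (simp add: negligible_iff_null_sets AE_iff_null_sets)
  then show False
    using open_not_negligible[OF \<open>open ?N\<close>] assms(4) \<open>g x \<noteq> 0\<close> by blast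
qed

section \<open>Integration by parts along the Euler field\<close>

lemma normK_nonneg: "0 \<le> normK K x"
  by (simp add: normK_def sum_nonneg)

lemma normK_power2: "(normK K x)\<^sup>2 = (\<Sum>i\<in>K. (x$i)\<^sup>2)"
  by (simp add: normK_def sum_nonneg)

lemma continuous_on_normK [continuous_intros]: "continuous_on S (normK K)"
  unfolding normK_def by (intro continuous_intros)

lemma open_OmegaR: "open (OmegaR K R)"
  unfolding OmegaR_def by (intro open_Collect_conj open_Collect_less continuous_intros)

lemma OmegaR_D:
  assumes "x \<in> OmegaR K R"
  shows "normK K x > 0" "normK K x < R" "Lg K R x > 0"
  using assms by (auto simp: OmegaR_def Lg_def)

lemma continuous_on_Lg [continuous_intros]: "S \<subseteq> OmegaR K R \<Longrightarrow> continuous_on S (Lg K R)"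
  unfolding Lg_def by (intro continuous_intros) (auto simp: OmegaR_def)

lemma has_derivative_component: "((\<lambda>x::real^'n::finite. x$j) has_derivative (\<lambda>h. h$j)) F"
  by (rule bounded_linear_imp_has_derivative[OF bounded_linear_vec_nth])

lemma has_derivative_normK_power2:
  fixes x :: "real^'n::finite"
  shows "((\<lambda>x. (normK K x)\<^sup>2) has_derivative (\<lambda>h. \<Sum>i\<in>K. 2 * (x$i * h$i))) (at x)"
  unfolding normK_power2
proof (rule has_derivative_sum)
  show "((\<lambda>x. (x$i)\<^sup>2) has_derivative (\<lambda>h. 2 * (x$i * h$i))) (at x)" for i
    unfolding power2_eq_square
    by (rule has_derivative_eq_rhs[OF has_derivative_mult[OF
          has_derivative_component has_derivative_component]]) (simp add: mult.commute)
qed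

lemma has_derivative_normK:
  fixes x :: "real^'a::finite"
  assumes "normK K x > 0"
  shows "(normK K has_derivative (\<lambda>h. (\<Sum>i\<in>K. x$i * h$i) / normK K x)) (at x)"
proof -
  have s: "(\<Sum>i\<in>K. (x$i)\<^sup>2) > 0" using assms by (simp add: normK_def)
  have "((\<lambda>x. \<Sum>i\<in>K. (x$i)\<^sup>2) has_derivative (\<lambda>h. \<Sum>i\<in>K. 2 * (x$i * h$i))) (at x)"
    using has_derivative_normK_power2[of K x] unfolding normK_power2 .
  from DERIV_compose_FDERIV[OF DERIV_real_sqrt[OF s] this]
  have d: "((\<lambda>x. sqrt (\<Sum>i\<in>K. (x$i)\<^sup>2)) has_derivative
      (\<lambda>h. (\<Sum>i\<in>K. 2 * (x$i * h$i)) * (inverse (sqrt (\<Sum>i\<in>K. (x$i)\<^sup>2)) / 2))) (at x)" .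
  have 1: "normK K = (\<lambda>x. sqrt (\<Sum>i\<in>K. (x$i)\<^sup>2))"
    by (rule ext) (rule normK_def)
  have 2: "(\<Sum>i\<in>K. 2 * (x$i * h$i)) = 2 * (\<Sum>i\<in>K. x$i * h$i)" for h :: "real^'a"
    by (rule sum_distrib_left[symmetric])
  have 3: "2 * u * (inverse v / 2) = u / v" for u v :: real
    by (simp add: field_simps)
  show ?thesis using d unfolding 1 2 3 .
qed

text \<open>The Euler field on the \<open>K\<close>-coordinates has divergence \<open>card K\<close>.\<close>

lemma integral_euler_field:
  fixes G :: "real^'n::finite \<Rightarrow> real"
  assumes der: "\<And>x. (G has_derivative G' x) (at x)"
    and cont: "\<And>j. continuous_on UNIV (\<lambda>x. G' x (axis j 1))"
    and S: "compact S" "\<And>x. x \<notin> S \<Longrightarrow> G x = 0" "\<And>x h. x \<notin> S \<Longrightarrow> G' x h = 0"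
  shows "(\<integral>x. (\<Sum>j\<in>K. x$j * G' x (axis j 1)) \<partial>lborel) = - real (card K) * (\<integral>x. G x \<partial>lborel)"
proof -
  have contG: "continuous_on UNIV G"
    using has_derivative_continuous[OF der] by (simp add: continuous_on_eq_continuous_at)
  have intG: "integrable lborel G"
    using contG S by (intro integrable_lborel_compact_support) auto
  have int: "integrable lborel (\<lambda>x. x$j * G' x (axis j 1))" for j
    using cont S by (intro integrable_lborel_compact_support[of _ S] continuous_intros) auto
  have each: "(\<integral>x. x$j * G' x (axis j 1) \<partial>lborel) = - (\<integral>x. G x \<partial>lborel)" for j
  proof -
    \<comment> \<open>The integrand is the j-th partial derivative of x_j G, again a compactly
      supported C^1 function. Each j in K contributes one copy of G, whence the factor
      \<open>card K\<close>.\<close>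
    have "(\<integral>x. x$j * G' x (axis j 1) + G x \<partial>lborel) = 0"
    proof -
      have "((\<lambda>x. x$j * G x) has_derivative (\<lambda>h. x$j * G' x h + h$j * G x)) (at x)" for x
        by (rule has_derivative_mult[OF has_derivative_component der])
      moreover have "continuous_on UNIV (\<lambda>x. x$j * G' x (axis j 1) + axis j 1 $ j * G x)"
        by (intro continuous_intros cont contG)
      ultimately have "(\<integral>x. x$j * G' x (axis j 1) + axis j 1 $ j * G x \<partial>lborel) = 0"
        by (rule integral_derivative_compact_support[where S = S]) (use S in auto)
      then show ?thesis by (simp add: axis_def)
    qed
    then show ?thesis using intG int[of j] by simp
  qed
  show ?thesis using int by (simp add: each)
qed

section \<open>Test functions: derivatives, supports and integrability\<close>

lemma test_fun_differentiable:
  assumes "test_fun K R f"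
  shows test_fun_has_derivative: "(f has_derivative frechet_derivative f (at x)) (at x)"
    and continuous_on_test_fun: "continuous_on S f"
    and continuous_on_pderivc_test_fun: "continuous_on S (pderivc f j)"
proof -
  have "f differentiable_on UNIV" "pderivc f j differentiable_on UNIV"
    using assms unfolding test_fun_def smooth_fun_def by blast+
  then have d: "f differentiable (at y)" "pderivc f j differentiable (at y)" for y
    by (simp_all add: differentiable_on_def)
  show "(f has_derivative frechet_derivative f (at x)) (at x)"
    using d(1) frechet_derivative_works by blast
  show "continuous_on S f" "continuous_on S (pderivc f j)"
    using d[THEN differentiable_imp_continuous_within] by (simp_all add: continuous_at_imp_continuous_on)
qed

lemma continuous_on_xgrad_test_fun:
  assumes "test_fun K R f"
  shows "continuous_on S (xgrad K f)"
  unfolding xgrad_def by (intro continuous_intros continuous_on_pderivc_test_fun[OF assms])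

lemma outside_support: "x \<notin> closure {x. f x \<noteq> 0} \<Longrightarrow> f x = 0"
  using closure_subset[of "{x. f x \<noteq> 0}"] by blast

lemma frechet_derivative_outside_support:
  fixes f :: "'a::real_normed_vector \<Rightarrow> 'b::real_normed_vector"
  assumes "x \<notin> closure {x. f x \<noteq> 0}"
  shows "frechet_derivative f (at x) = (\<lambda>_. 0)"
proof -
  have "(f has_derivative (\<lambda>_. 0)) (at x)"
  proof (rule has_derivative_transform_within_open)
    show "((\<lambda>_. 0) has_derivative (\<lambda>_. 0)) (at x)" by (rule has_derivative_const)
    show "open (- closure {x. f x \<noteq> 0})" by (intro open_Compl closed_closure)
    show "x \<in> - closure {x. f x \<noteq> 0}" using assms by simp
    show "0 = f y" if "y \<in> - closure {x. f x \<noteq> 0}" for y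
      using outside_support[of y f] that by simp
  qed
  then show ?thesis by (rule frechet_derivative_at[symmetric])
qed

lemma xgrad_outside_support:
  assumes "x \<notin> closure {x. f x \<noteq> 0}"
  shows "xgrad K f x = 0"
  using frechet_derivative_outside_support[OF assms] by (simp add: xgrad_def pderivc_def)

lemma
  fixes g :: "real^'n::finite \<Rightarrow> real"
  assumes "test_fun K R f" "continuous_on (OmegaR K R) g"
    and "\<And>x. x \<in> OmegaR K R \<Longrightarrow> x \<notin> closure {x. f x \<noteq> 0} \<Longrightarrow> g x = 0"
  shows integrable_OmegaR: "integrable (lebesgue_on (OmegaR K R)) g"
    and integral_OmegaR:
      "integral\<^sup>L (lebesgue_on (OmegaR K R)) g = (\<integral>x. (if x \<in> OmegaR K R then g x else 0) \<partial>lborel)"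
  by (rule integrable_lebesgue_on_compact_support[of _ "closure {x. f x \<noteq> 0}"]
        integral_lebesgue_on_compact_support[of _ "closure {x. f x \<noteq> 0}"];
      use assms open_OmegaR in \<open>auto simp: test_fun_def\<close>)+

text \<open>Stated for a general g so that it serves both f and \<open>xgrad K f\<close>.\<close>

lemma integrable_weighted_powr:
  assumes "test_fun K R f" "p > 0" "continuous_on (OmegaR K R) g"
    and "\<And>x. x \<notin> closure {x. f x \<noteq> 0} \<Longrightarrow> g x = 0"
  shows "integrable (lebesgue_on (OmegaR K R))
    (\<lambda>x. cmod (g x) powr p / (normK K x powr a * Lg K R x powr b))"
proof (rule integrable_OmegaR[OF assms(1)])
  show "continuous_on (OmegaR K R) (\<lambda>x. cmod (g x) powr p / (normK K x powr a * Lg K R x powr b))"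
    using assms(2,3) by (intro continuous_intros continuous_on_powr' order_refl) (auto dest: OmegaR_D)
qed (use assms in auto)

text \<open>The second term on the right comes from the Euler field mapping \<open>L\<close> to the constant \<open>-1\<close>.\<close>

lemma integral_euler_cmod_powr:
  fixes K :: "'n::finite set" and a c :: real
  assumes f: "test_fun K R f" and p: "1 < p"
  defines "D \<equiv> \<lambda>x. p * Re (complex_of_real (cmod (f x) powr (p - 2)) * f x * cnj (xgrad K f x))
                / (normK K x powr a * Lg K R x powr c)"
  shows "integrable (lebesgue_on (OmegaR K R)) D"
    and "integral\<^sup>L (lebesgue_on (OmegaR K R)) D
      = (a - real (card K)) * Ifw K R p a c f - c * Ifw K R p a (c + 1) f"
proof -
  let ?\<Omega> = "OmegaR K R" and ?S = "closure {x. f x \<noteq> 0}"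
  define F where "F b x = cmod (f x) powr p / (normK K x powr a * Lg K R x powr b)" for b x
  define u where "u x = complex_of_real (cmod (f x) powr (p - 2)) * f x" for x
  define \<omega> where "\<omega> r = r powr (- a) * ln (R / r) powr (- c)" for r
  \<comment> \<open>The derivative of the radial weight, factored so that multiplication by r
    restores r^(-a) and leaves the two powers of L that occur in \<open>F c\<close> and
    \<open>F (c + 1)\<close>.\<close>
  define \<omega>' where "\<omega>' r = r powr (- a - 1) * (- a * ln (R / r) powr (- c) + c * ln (R / r) powr (- c - 1))" for r
  define G where "G x = cmod (f x) powr p * \<omega> (normK K x)" for x
  define G' where "G' x h = (if x \<in> ?\<Omega> then cmod (f x) powr p * (\<omega>' (normK K x) * ((\<Sum>i\<in>K. x$i * h$i) / normK K x))
      + p * Re (u x * cnj (frechet_derivative f (at x) h)) * \<omega> (normK K x) else 0)" for x h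
  have S: "compact ?S" "?S \<subseteq> ?\<Omega>" using f by (auto simp: test_fun_def)
  have r0: "normK K x \<noteq> 0" and l0: "Lg K R x \<noteq> 0" if "x \<in> ?\<Omega>" for x
    using OmegaR_D[OF that] by auto
  have contf: "continuous_on A f" for A by (rule continuous_on_test_fun[OF f])
  have contu: "continuous_on A u" for A
    unfolding u_def
    by (rule continuous_on_compose2[OF continuous_on_powr_times[OF p] contf]) auto
  have contw: "continuous_on ?\<Omega> (\<lambda>x. normK K x powr a)" "continuous_on ?\<Omega> (\<lambda>x. Lg K R x powr a)" for a
    using r0 l0 by (auto intro!: continuous_intros)
  have contn: "continuous_on ?\<Omega> (\<lambda>x. \<omega> (normK K x))" "continuous_on ?\<Omega> (\<lambda>x. \<omega>' (normK K x))"
    unfolding \<omega>_def \<omega>'_def Lg_def[symmetric] by (intro continuous_intros contw)+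
  have contF: "continuous_on ?\<Omega> (F b)" for b
    unfolding F_def using r0 l0 p
    by (intro continuous_intros contw contf continuous_on_powr') auto
  have contD: "continuous_on ?\<Omega> D"
    unfolding D_def u_def[symmetric] using r0 l0
    by (intro continuous_intros contw contu continuous_on_xgrad_test_fun[OF f]) auto
  have der\<omega>: "(\<omega> has_real_derivative \<omega>' r) (at r)" if "0 < r" "r < R" for r
  proof -
    have l: "ln (R / r) > 0" using that by simp
    have "((\<lambda>r. ln (R / r)) has_real_derivative - 1 / r) (at r)"
      using that by (auto intro!: derivative_eq_intros simp: field_simps)
    from DERIV_fun_powr[OF this l, of "- c"]
    have "((\<lambda>r. ln (R / r) powr (- c)) has_real_derivative - c * ln (R / r) powr (- c - 1) * (- 1 / r)) (at r)"
      by simp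
    then have "(\<omega> has_real_derivative (- a * r powr (- a - 1)) * ln (R / r) powr (- c)
       + (- c * ln (R / r) powr (- c - 1) * (- 1 / r)) * r powr (- a)) (at r)"
      unfolding \<omega>_def using that l by (intro DERIV_mult has_real_derivative_powr) auto
    moreover have "r powr (- a) = r * r powr (- a - 1)"
      using that by (simp add: powr_diff)
    ultimately show ?thesis using that by (simp add: \<omega>'_def algebra_simps)
  qed
  have der: "(G has_derivative G' x) (at x)" for x
  proof (cases "x \<in> ?\<Omega>")
    case True
    have 1: "((\<lambda>x. cmod (f x) powr p) has_derivative
         (\<lambda>h. p * Re (u x * cnj (frechet_derivative f (at x) h)))) (at x)"
      unfolding u_def
      by (rule has_derivative_compose[OF test_fun_has_derivative[OF f] has_derivative_cmod_powr[OF p]])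
    have "(\<omega> has_derivative (*) (\<omega>' (normK K x))) (at (normK K x))"
      using der\<omega> OmegaR_D[OF True] by (simp add: has_field_derivative_def)
    from has_derivative_compose[OF has_derivative_normK[OF OmegaR_D(1)[OF True]] this]
    have 2: "((\<lambda>x. \<omega> (normK K x)) has_derivative
         (\<lambda>h. \<omega>' (normK K x) * ((\<Sum>i\<in>K. x$i * h$i) / normK K x))) (at x)" .
    show ?thesis
      using has_derivative_mult[OF 1 2] True unfolding G_def[abs_def] G'_def[abs_def] by simp
  next
    case False
    then have x: "x \<in> - ?S" using S by auto
    have "(G has_derivative (\<lambda>_. 0)) (at x)"
    proof (rule has_derivative_transform_within_open[OF has_derivative_const _ x])
      show "open (- ?S)" by (intro open_Compl closed_closure)
      show "0 = G y" if "y \<in> - ?S" for y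
        using that outside_support[of y f] p by (simp add: G_def)
    qed
    then show ?thesis using False by (simp add: G'_def[abs_def])
  qed
  have G'0: "G' x h = 0" if "x \<notin> ?S" for x h
    using that outside_support[of x f] p frechet_derivative_outside_support[of x f]
    by (simp add: G'_def)
  have G0: "G x = 0" if "x \<notin> ?S" for x
    using that outside_support[of x f] p by (simp add: G_def)
  have "continuous_on UNIV (\<lambda>x. G' x (axis j 1))" for j
  proof (rule continuous_on_UNIV_extend_zero[OF open_OmegaR _ S(2)])
    have "continuous_on ?\<Omega> (\<lambda>x. cmod (f x) powr p * (\<omega>' (normK K x) * ((\<Sum>i\<in>K. x$i * axis j 1 $ i) / normK K x))
      + p * Re (u x * cnj (pderivc f j x)) * \<omega> (normK K x))"
      using r0 p
      by (intro continuous_intros continuous_on_powr' contf contn contu continuous_on_pderivc_test_fun[OF f]) auto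
    moreover have "G' x (axis j 1) = cmod (f x) powr p * (\<omega>' (normK K x) * ((\<Sum>i\<in>K. x$i * axis j 1 $ i) / normK K x))
      + p * Re (u x * cnj (pderivc f j x)) * \<omega> (normK K x)" if "x \<in> ?\<Omega>" for x
      using that by (simp add: G'_def pderivc_def)
    ultimately show "continuous_on ?\<Omega> (\<lambda>x. G' x (axis j 1))"
      by (simp cong: continuous_on_cong)
  qed (use G'0 in auto)
  from integral_euler_field[OF der this S(1) G0 G'0, of K]
  have euler: "(\<integral>x. (\<Sum>j\<in>K. x$j * G' x (axis j 1)) \<partial>lborel) = - real (card K) * (\<integral>x. G x \<partial>lborel)" .
  \<comment> \<open>The Euler field acts on a radial weight as r d/dr: r^(-a) contributes the factor
    -a, and L^(-c) contributes c / L since r dL/dr = -1.\<close>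
  have sumG': "(\<Sum>j\<in>K. x$j * G' x (axis j 1)) = D x - a * F c x + c * F (c + 1) x" if x: "x \<in> ?\<Omega>" for x
  proof -
    let ?r = "normK K x"
    have r: "?r > 0" and l: "Lg K R x > 0" using OmegaR_D[OF x] by auto
    have "(\<Sum>i\<in>K. x$i * axis j 1 $ i) = x$j" if "j \<in> K" for j
      using that by (simp add: axis_def if_distrib[of "\<lambda>z. _ * z"] cong: if_cong)
    then have s1: "(\<Sum>j\<in>K. x$j * (\<Sum>i\<in>K. x$i * axis j 1 $ i)) = ?r\<^sup>2"
      unfolding normK_power2 by (simp add: power2_eq_square)
    have s2: "(\<Sum>j\<in>K. x$j * Re (u x * cnj (frechet_derivative f (at x) (axis j 1)))) = Re (u x * cnj (xgrad K f x))"
      by (simp add: xgrad_def pderivc_def sum_distrib_left sum.distrib algebra_simps)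
    have "(\<Sum>j\<in>K. x$j * G' x (axis j 1))
        = cmod (f x) powr p * \<omega>' ?r / ?r * (\<Sum>j\<in>K. x$j * (\<Sum>i\<in>K. x$i * axis j 1 $ i))
         + p * \<omega> ?r * (\<Sum>j\<in>K. x$j * Re (u x * cnj (frechet_derivative f (at x) (axis j 1))))"
    proof -
      have "x$j * G' x (axis j 1) = cmod (f x) powr p * \<omega>' ?r / ?r * (x$j * (\<Sum>i\<in>K. x$i * axis j 1 $ i))
         + p * \<omega> ?r * (x$j * Re (u x * cnj (frechet_derivative f (at x) (axis j 1))))" for j
        using x by (simp add: G'_def distrib_left mult_ac del: times_complex.sel)
      then show ?thesis by (simp only: sum.distrib sum_distrib_left[symmetric])
    qed
    also have "\<dots> = cmod (f x) powr p * (\<omega>' ?r * ?r) + p * Re (u x * cnj (xgrad K f x)) * \<omega> ?r"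
      unfolding s1 s2 using r by (simp add: power2_eq_square del: times_complex.sel)
    also have "\<omega>' ?r * ?r = (- a / (?r powr a * Lg K R x powr c) + c / (?r powr a * Lg K R x powr (c + 1)))"
      using r l by (simp add: \<omega>'_def powr_diff powr_minus powr_add Lg_def[symmetric] field_simps)
    also have "\<omega> ?r = 1 / (?r powr a * Lg K R x powr c)"
      by (simp add: \<omega>_def powr_minus Lg_def[symmetric] field_simps)
    finally show ?thesis unfolding D_def F_def u_def[symmetric]
      by (simp add: distrib_left right_diff_distrib mult.commute[of c] mult.commute[of a] del: times_complex.sel)
  qed
  have F0: "F b x = 0" if "x \<notin> ?S" for b x
    using outside_support[OF that] p by (simp add: F_def)
  have D0: "D x = 0" if "x \<notin> ?S" for x
    using outside_support[OF that] by (simp add: D_def)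
  have E0: "D x - a * F c x + c * F (c + 1) x = 0" if "x \<notin> ?S" for x
    using D0[OF that] F0[OF that] by simp
  have intF: "integrable (lebesgue_on ?\<Omega>) (F b)" for b
    by (rule integrable_OmegaR[OF f contF F0])
  show intD: "integrable (lebesgue_on ?\<Omega>) D"
    by (rule integrable_OmegaR[OF f contD D0])
  have contE: "continuous_on ?\<Omega> (\<lambda>x. D x - a * F c x + c * F (c + 1) x)"
    by (intro continuous_intros contD contF)
  have "integral\<^sup>L (lebesgue_on ?\<Omega>) (\<lambda>x. D x - a * F c x + c * F (c + 1) x)
      = (\<integral>x. (if x \<in> ?\<Omega> then D x - a * F c x + c * F (c + 1) x else 0) \<partial>lborel)"
    by (rule integral_OmegaR[OF f contE E0])
  also have "\<dots> = (\<integral>x. (\<Sum>j\<in>K. x$j * G' x (axis j 1)) \<partial>lborel)"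
  proof (intro Bochner_Integration.integral_cong refl)
    show "(if x \<in> ?\<Omega> then D x - a * F c x + c * F (c + 1) x else 0) = (\<Sum>j\<in>K. x$j * G' x (axis j 1))" for x
      by (cases "x \<in> ?\<Omega>") (simp_all only: sumG' if_True, simp add: G'_def)
  qed
  also have "\<dots> = - real (card K) * integral\<^sup>L (lebesgue_on ?\<Omega>) (F c)"
  proof -
    have "(if x \<in> ?\<Omega> then F c x else 0) = G x" for x
    proof (cases "x \<in> ?\<Omega>")
      case True
      then show ?thesis by (simp add: F_def G_def \<omega>_def powr_minus_divide Lg_def)
    next
      case False
      then have "x \<notin> ?S" using S(2) by auto
      then show ?thesis using G0 False by simp
    qed
    moreover have "integral\<^sup>L (lebesgue_on ?\<Omega>) (F c) = (\<integral>x. (if x \<in> ?\<Omega> then F c x else 0) \<partial>lborel)"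
      by (rule integral_OmegaR[OF f contF F0])
    ultimately show ?thesis by (simp only: euler)
  qed
  finally have "integral\<^sup>L (lebesgue_on ?\<Omega>) D - a * integral\<^sup>L (lebesgue_on ?\<Omega>) (F c)
      + c * integral\<^sup>L (lebesgue_on ?\<Omega>) (F (c + 1)) = - real (card K) * integral\<^sup>L (lebesgue_on ?\<Omega>) (F c)"
    using intF intD by simp
  moreover have "integral\<^sup>L (lebesgue_on ?\<Omega>) (F b) = Ifw K R p a b f" for b
    by (simp add: Ifw_def F_def[abs_def])
  ultimately show "integral\<^sup>L (lebesgue_on ?\<Omega>) D
      = (a - real (card K)) * Ifw K R p a c f - c * Ifw K R p a (c + 1) f"
    by (simp add: algebra_simps)
qed

section \<open>The identity, the inequality and the equality case\<close>

text \<open>If s and s' are the denominators belonging to \<open>xgrad K f\<close> and to f, then s'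
  = s L. Hence s'^(p-1) s = s'^p / L, so the cross term carries the weight with exponent beta + p,
  between those of the other two terms.\<close>

lemma Cp_xi_eta:
  assumes x: "x \<in> OmegaR K R" and p: "1 < p"
  shows "Cp p (xi_fun K R p \<alpha> \<beta> f x) (eta_fun K R p \<alpha> \<beta> f x)
    = cmod (xgrad K f x) powr p / (normK K x powr (\<alpha> + p) * Lg K R x powr (\<beta> + 1))
      + (p - 1) * \<bar>(\<beta> + p) / p\<bar> powr p
          * (cmod (f x) powr p / (normK K x powr (\<alpha> + p) * Lg K R x powr (\<beta> + p + 1)))
      + (\<beta> + p) / p * \<bar>(\<beta> + p) / p\<bar> powr (p - 2)
          * (p * Re (of_real (cmod (f x) powr (p - 2)) * f x * cnj (xgrad K f x))
               / (normK K x powr (\<alpha> + p) * Lg K R x powr (\<beta> + p)))"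
proof -
  define r where "r = normK K x"
  define l where "l = Lg K R x"
  have r: "r > 0" and l: "l > 0" using OmegaR_D[OF x] by (auto simp: r_def l_def)
  define s where "s = r powr ((\<alpha> + p) / p) * l powr ((\<beta> + 1) / p)"
  define s' where "s' = r powr ((\<alpha> + p) / p) * l powr ((\<beta> + p + 1) / p)"
  have s: "s > 0" and s': "s' > 0" using r l by (simp_all add: s_def s'_def)
  have sp: "s powr p = r powr (\<alpha> + p) * l powr (\<beta> + 1)"
    using p by (simp add: s_def powr_mult powr_powr)
  have sp': "s' powr p = r powr (\<alpha> + p) * l powr (\<beta> + p + 1)"
    using p by (simp add: s'_def powr_mult powr_powr)
  have "s' = s * l"
    using p l by (simp add: s_def s'_def add_divide_distrib powr_add)
  then have "s' powr (p - 1) * s = s' powr p / l"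
    using s' s l by (simp add: powr_diff)
  also have "\<dots> = r powr (\<alpha> + p) * l powr (\<beta> + p)"
    using l by (simp add: sp' powr_add)
  finally have sm: "s' powr (p - 1) * s = r powr (\<alpha> + p) * l powr (\<beta> + p)" .
  show ?thesis
    using Cp_expand[OF p s s', of "xgrad K f x" "(\<beta> + p) / p" "f x"]
    unfolding sp sp' sm
    unfolding xi_fun_def eta_fun_def r_def l_def s_def s'_def .
qed

text \<open>Integrating the cross term yields -p |b|^p times the weighted integral of |f|^p, because
  beta + p = p b. Added to the (p - 1) |b|^p of the pointwise expansion, this leaves exactly
  -|b|^p.\<close>

lemma
  fixes K :: "'n::finite set"
  assumes f: "test_fun K R f" and p: "1 < p"
  shows integrable_Cp: "integrable (lebesgue_on (OmegaR K R))
      (\<lambda>x. Cp p (xi_fun K R p \<alpha> \<beta> f x) (eta_fun K R p \<alpha> \<beta> f x))"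
    and hardy_identity: "\<bar>(\<beta> + p) / p\<bar> powr p * Ifw K R p (\<alpha> + p) (\<beta> + p + 1) f
        = (\<integral>x. cmod (xgrad K f x) powr p / (normK K x powr (\<alpha> + p) * Lg K R x powr (\<beta> + 1))
              \<partial>(lebesgue_on (OmegaR K R)))
          - (real (card K) - \<alpha> - p) * ((\<beta> + p) / p) * \<bar>(\<beta> + p) / p\<bar> powr (p - 2)
              * Ifw K R p (\<alpha> + p) (\<beta> + p) f
          - (\<integral>x. Cp p (xi_fun K R p \<alpha> \<beta> f x) (eta_fun K R p \<alpha> \<beta> f x)
              \<partial>(lebesgue_on (OmegaR K R)))"
proof -
  let ?M = "lebesgue_on (OmegaR K R)"
  let ?C = "\<lambda>x. Cp p (xi_fun K R p \<alpha> \<beta> f x) (eta_fun K R p \<alpha> \<beta> f x)"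
  define b where "b = (\<beta> + p) / p"
  define J where "J x = cmod (xgrad K f x) powr p / (normK K x powr (\<alpha> + p) * Lg K R x powr (\<beta> + 1))" for x
  define I where "I x = cmod (f x) powr p / (normK K x powr (\<alpha> + p) * Lg K R x powr (\<beta> + p + 1))" for x
  define D where "D x = p * Re (of_real (cmod (f x) powr (p - 2)) * f x * cnj (xgrad K f x))
               / (normK K x powr (\<alpha> + p) * Lg K R x powr (\<beta> + p))" for x
  have C_eq: "?C x = J x + (p - 1) * \<bar>b\<bar> powr p * I x + b * \<bar>b\<bar> powr (p - 2) * D x" if "x \<in> OmegaR K R" for x
    unfolding b_def J_def I_def D_def by (rule Cp_xi_eta[OF that p])
  have intJ: "integrable ?M J" unfolding J_def
    using p by (intro integrable_weighted_powr[OF f] continuous_on_xgrad_test_fun[OF f] xgrad_outside_support) simp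
  have intI: "integrable ?M I" unfolding I_def
    using p by (intro integrable_weighted_powr[OF f] continuous_on_test_fun[OF f] outside_support) simp
  have intD: "integrable ?M D" unfolding D_def by (rule integral_euler_cmod_powr(1)[OF f p])
  have "integral\<^sup>L ?M D = (\<alpha> + p - real (card K)) * Ifw K R p (\<alpha> + p) (\<beta> + p) f
      - (\<beta> + p) * Ifw K R p (\<alpha> + p) (\<beta> + p + 1) f"
    unfolding D_def by (rule integral_euler_cmod_powr(2)[OF f p])
  then have D: "integral\<^sup>L ?M D = (\<alpha> + p - real (card K)) * Ifw K R p (\<alpha> + p) (\<beta> + p) f
      - p * b * integral\<^sup>L ?M I"
    using p by (simp add: I_def[abs_def] Ifw_def b_def)
  have "integrable ?M (\<lambda>x. J x + (p - 1) * \<bar>b\<bar> powr p * I x + b * \<bar>b\<bar> powr (p - 2) * D x)"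
    using intJ intI intD by simp
  then show "integrable ?M ?C"
    by (rule Bochner_Integration.integrable_cong[THEN iffD1, rotated -1]) (auto simp: C_eq)
  have "integral\<^sup>L ?M ?C = (\<integral>x. J x + (p - 1) * \<bar>b\<bar> powr p * I x + b * \<bar>b\<bar> powr (p - 2) * D x \<partial>?M)"
    by (rule Bochner_Integration.integral_cong) (auto simp: C_eq)
  also have "\<dots> = integral\<^sup>L ?M J + (p - 1) * \<bar>b\<bar> powr p * integral\<^sup>L ?M I
      + b * \<bar>b\<bar> powr (p - 2) * integral\<^sup>L ?M D"
    using intJ intI intD by simp
  also have "\<dots> = integral\<^sup>L ?M J + (p - 1) * \<bar>b\<bar> powr p * integral\<^sup>L ?M I
      - p * (b * b * \<bar>b\<bar> powr (p - 2)) * integral\<^sup>L ?M I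
      - (real (card K) - \<alpha> - p) * b * \<bar>b\<bar> powr (p - 2) * Ifw K R p (\<alpha> + p) (\<beta> + p) f"
    unfolding D by (simp add: algebra_simps)
  also have "b * b * \<bar>b\<bar> powr (p - 2) = \<bar>b\<bar> powr p"
    by (cases "b = 0") (simp_all add: powr_diff power2_eq_square)
  finally have "\<bar>b\<bar> powr p * integral\<^sup>L ?M I = integral\<^sup>L ?M J
     - (real (card K) - \<alpha> - p) * b * \<bar>b\<bar> powr (p - 2) * Ifw K R p (\<alpha> + p) (\<beta> + p) f - integral\<^sup>L ?M ?C"
    by (simp add: algebra_simps)
  then show "\<bar>(\<beta> + p) / p\<bar> powr p * Ifw K R p (\<alpha> + p) (\<beta> + p + 1) f
        = (\<integral>x. cmod (xgrad K f x) powr p / (normK K x powr (\<alpha> + p) * Lg K R x powr (\<beta> + 1)) \<partial>?M)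
          - (real (card K) - \<alpha> - p) * ((\<beta> + p) / p) * \<bar>(\<beta> + p) / p\<bar> powr (p - 2)
              * Ifw K R p (\<alpha> + p) (\<beta> + p) f
          - integral\<^sup>L ?M ?C"
    by (simp only: I_def[abs_def] J_def[abs_def] Ifw_def b_def)
qed

lemma hardy_inequality:
  fixes K :: "'n::finite set"
  assumes f: "test_fun K R f" and p: "1 < p" and cond: "(real (card K) - \<alpha> - p) * (\<beta> + p) \<ge> 0"
  shows "\<bar>(\<beta> + p) / p\<bar> powr p * Ifw K R p (\<alpha> + p) (\<beta> + p + 1) f
      \<le> (\<integral>x. cmod (xgrad K f x) powr p / (normK K x powr (\<alpha> + p) * Lg K R x powr (\<beta> + 1))
            \<partial>(lebesgue_on (OmegaR K R)))"
proof -
  have "0 \<le> Ifw K R p (\<alpha> + p) (\<beta> + p) f"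
    unfolding Ifw_def by (intro Bochner_Integration.integral_nonneg) simp
  moreover have "0 \<le> (real (card K) - \<alpha> - p) * ((\<beta> + p) / p)"
    using cond p by simp
  ultimately have "0 \<le> (real (card K) - \<alpha> - p) * ((\<beta> + p) / p) * \<bar>(\<beta> + p) / p\<bar> powr (p - 2)
              * Ifw K R p (\<alpha> + p) (\<beta> + p) f"
    by (rule mult_nonneg_nonneg[OF mult_nonneg_nonneg[OF _ powr_ge_zero], rotated])
  moreover have "0 \<le> (\<integral>x. Cp p (xi_fun K R p \<alpha> \<beta> f x) (eta_fun K R p \<alpha> \<beta> f x) \<partial>(lebesgue_on (OmegaR K R)))"
    by (intro Bochner_Integration.integral_nonneg Cp_nonneg p)
  ultimately show ?thesis using hardy_identity[OF f p, of \<beta> \<alpha>] by linarith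
qed

text \<open>Where \<open>\<eta>\<close> vanishes identically, \<open>f / L^((\<beta>+p)/p)\<close> is constant along the rays
  \<open>s \<mapsto> (s x', x'')\<close>, and these leave the compact support of \<open>f\<close> as \<open>s \<rightarrow> 0\<close>.\<close>

lemma integral_Cp_eq_0_imp:
  fixes K :: "'n::finite set"
  assumes f: "test_fun K R f" and p: "1 < p"
    and C0: "(\<integral>x. Cp p (xi_fun K R p \<alpha> \<beta> f x) (eta_fun K R p \<alpha> \<beta> f x) \<partial>(lebesgue_on (OmegaR K R))) = 0"
  shows "f x = 0"
proof (cases "x \<in> OmegaR K R")
  case False
  then have "x \<notin> closure {x. f x \<noteq> 0}" using f by (auto simp: test_fun_def)
  then show ?thesis by (rule outside_support)
next
  case x: True
  let ?\<Omega> = "OmegaR K R" and ?S = "closure {x. f x \<noteq> 0}"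
  define b where "b = (\<beta> + p) / p"
  define r where "r = normK K x"
  have r: "0 < r" "r < R" using OmegaR_D[OF x] by (auto simp: r_def)
  have "AE x in lebesgue_on ?\<Omega>. Cp p (xi_fun K R p \<alpha> \<beta> f x) (eta_fun K R p \<alpha> \<beta> f x) = 0"
    using integral_nonneg_eq_0_iff_AE[OF integrable_Cp[OF f p]] C0 Cp_nonneg[OF p] by auto
  then have ae: "AE x in lebesgue_on ?\<Omega>. eta_fun K R p \<alpha> \<beta> f x = 0"
    by (rule AE_mp) (auto intro!: AE_I2 dest: Cp_eq_0_imp[OF p])
  have nz: "normK K x \<noteq> 0" "Lg K R x \<noteq> 0" if "x \<in> ?\<Omega>" for x
    using OmegaR_D[OF that] by auto
  have cont: "continuous_on ?\<Omega> (eta_fun K R p \<alpha> \<beta> f)"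
    unfolding eta_fun_def xi_fun_def using nz
    by (intro continuous_intros continuous_on_xgrad_test_fun[OF f] continuous_on_test_fun[OF f]) auto
  have eta0: "eta_fun K R p \<alpha> \<beta> f y = 0" if "y \<in> ?\<Omega>" for y
    by (rule open_AE_continuous_eq_0[OF open_OmegaR cont ae that])
  \<comment> \<open>Clearing denominators in eta = 0 gives a first-order linear equation along the
    Euler field.\<close>
  have ode: "xgrad K f y = - of_real (b / Lg K R y) * f y" if "y \<in> ?\<Omega>" for y
  proof -
    define s where "s = normK K y powr ((\<alpha> + p) / p) * Lg K R y powr ((\<beta> + 1) / p)"
    have l: "Lg K R y > 0" and s: "s > 0" using OmegaR_D[OF that] by (simp_all add: s_def)
    have "normK K y powr ((\<alpha> + p) / p) * Lg K R y powr ((\<beta> + p + 1) / p) = s * Lg K R y"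
      using p l by (simp add: s_def add_divide_distrib powr_add)
    then have "eta_fun K R p \<alpha> \<beta> f y = xgrad K f y / of_real s + of_real b * f y / of_real (s * Lg K R y)"
      by (simp only: eta_fun_def xi_fun_def b_def s_def)
    also have "\<dots> = (xgrad K f y + of_real (b / Lg K R y) * f y) / of_real s"
      by (simp add: add_divide_distrib mult_ac)
    finally have "xgrad K f y + of_real (b / Lg K R y) * f y = 0"
      using eta0[OF that] s by simp
    then show ?thesis by (simp add: eq_neg_iff_add_eq_0)
  qed
  define \<gamma> where "\<gamma> s = (\<chi> i. if i \<in> K then s * x$i else x$i)" for s
  have \<gamma>_split: "\<gamma> s = s *\<^sub>R (\<chi> i. if i \<in> K then x$i else 0) + (\<chi> i. if i \<in> K then 0 else x$i)" for s
    by (simp add: \<gamma>_def vec_eq_iff)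
  have norm\<gamma>: "normK K (\<gamma> s) = s * r" if "s \<ge> 0" for s
    using that by (simp add: normK_def \<gamma>_def r_def power_mult_distrib real_sqrt_mult flip: sum_distrib_left)
  have \<gamma>\<Omega>: "\<gamma> s \<in> ?\<Omega>" if "0 < s" "s < R / r" for s
    using that r norm\<gamma>[of s] by (simp add: OmegaR_def field_simps)
  have derf: "((\<lambda>s. f (\<gamma> s)) has_vector_derivative (of_real (1 / s) * xgrad K f (\<gamma> s))) (at s)" if "0 < s" for s
  proof -
    let ?Df = "frechet_derivative f (at (\<gamma> s))" and ?v = "\<chi> i. if i \<in> K then x$i else 0"
    have "(\<gamma> has_vector_derivative ?v) (at s)"
      unfolding \<gamma>_split[abs_def] by (auto intro!: derivative_eq_intros)
    from vector_derivative_diff_chain_within[OF this, of f ?Df]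
    have 1: "((\<lambda>s. f (\<gamma> s)) has_vector_derivative ?Df ?v) (at s)"
      using has_derivative_at_withinI[OF test_fun_has_derivative[OF f]] by (simp add: o_def)
    have lin: "linear ?Df" by (rule has_derivative_linear[OF test_fun_has_derivative[OF f]])
    have "?v = (\<Sum>j\<in>K. x$j *\<^sub>R axis j 1)"
      by (simp add: vec_eq_iff axis_def if_distrib[of "\<lambda>z. _ * z"] cong: if_cong)
    then have "?Df ?v = (\<Sum>j\<in>K. x$j *\<^sub>R ?Df (axis j 1))"
      using lin by (simp add: linear_sum linear_scale)
    also have "\<dots> = of_real (1 / s) * xgrad K f (\<gamma> s)"
      using that by (simp add: xgrad_def pderivc_def \<gamma>_def sum_distrib_left scaleR_conv_of_real)
    finally show ?thesis using 1 by simp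
  qed
  define l where "l s = ln (R / (s * r))" for s
  have l: "Lg K R (\<gamma> s) = l s" if "0 < s" for s
    using norm\<gamma>[of s] that by (simp add: Lg_def l_def)
  have lpos: "l s > 0" if "0 < s" "s < R / r" for s
    using that r by (simp add: l_def field_simps)
  have derl: "((\<lambda>s. l s powr (- b)) has_real_derivative (b * l s powr (- b - 1) / s)) (at s)"
    if "0 < s" "s < R / r" for s
  proof -
    have "(l has_real_derivative - 1 / s) (at s)"
      unfolding l_def using that r by (auto intro!: derivative_eq_intros simp: field_simps)
    from DERIV_fun_powr[OF this lpos[OF that], of "- b"] show ?thesis by simp
  qed
  \<comment> \<open>L^(-b) is the integrating factor of \<open>ode\<close>: the derivative of g
    along the ray vanishes. The ray stays in the domain for 0 < s < R / r, an interval that contains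
    1, where the ray passes through x.\<close>
  define g where "g s = l s powr (- b) *\<^sub>R f (\<gamma> s)" for s
  have derg: "(g has_vector_derivative 0) (at s)" if s: "0 < s" "s < R / r" for s
  proof -
    have "(g has_vector_derivative (l s powr (- b) *\<^sub>R (of_real (1 / s) * xgrad K f (\<gamma> s))
        + (b * l s powr (- b - 1) / s) *\<^sub>R f (\<gamma> s))) (at s)"
      unfolding g_def by (rule has_vector_derivative_scaleR[OF derl[OF s] derf[OF s(1)]])
    moreover have "l s powr (- b - 1) = l s powr (- b) / l s"
      using lpos[OF s] by (simp add: powr_diff)
    ultimately show ?thesis
      using ode[OF \<gamma>\<Omega>[OF s]] l[OF s(1)] by (simp add: scaleR_conv_of_real)
  qed
  obtain c where c: "\<And>s. s \<in> {0<..<R / r} \<Longrightarrow> g s = c"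
  proof (rule has_vector_derivative_zero_constant[of "{0<..<R / r}" g])
    show "(g has_vector_derivative 0) (at s within {0<..<R / r})" if "s \<in> {0<..<R / r}" for s
      using derg[of s] that by (auto intro: has_vector_derivative_at_within)
  qed auto
  \<comment> \<open>The values of |x'| on the support form a compact set missing 0, hence stay above
    some positive delta.\<close>
  have S\<Omega>: "?S \<subseteq> ?\<Omega>" and "compact ?S" using f by (simp_all add: test_fun_def)
  then have "closed (normK K ` ?S)"
    by (intro compact_imp_closed compact_continuous_image continuous_intros)
  moreover have "0 \<notin> normK K ` ?S"
    using nz(1) S\<Omega> by (metis imageE subsetD)
  ultimately have "\<exists>d>0. \<forall>t\<in>normK K ` ?S. d \<le> dist 0 t"
    by (rule separate_point_closed)
  then obtain \<delta> where \<delta>0: "\<delta> > 0" and \<delta>1: "\<forall>t\<in>normK K ` ?S. \<delta> \<le> dist 0 t" by (elim exE conjE)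
  have \<delta>: "\<delta> \<le> normK K y" if "y \<in> ?S" for y
    using bspec[OF \<delta>1 imageI[OF that]] normK_nonneg[of K y] by simp
  \<comment> \<open>Chosen so that the point of the ray has |x'| = s r < delta, off the support,
    while s < 1 keeps s in the interval where g is constant.\<close>
  define s where "s = min (1/2) (\<delta> / (2 * r))"
  have s: "0 < s" "s < 1" "s * r < \<delta>" "1 < R / r" using \<delta>0 r by (auto simp: s_def min_def field_simps)
  have "\<gamma> s \<notin> ?S" using \<delta>[of "\<gamma> s"] norm\<gamma>[of s] s by linarith
  from outside_support[OF this] have "g s = 0" by (simp add: g_def)
  then have "g 1 = 0" using c[of s] c[of 1] s by simp
  moreover have "\<gamma> 1 = x" by (simp add: \<gamma>_def vec_eq_iff)
  ultimately show ?thesis using lpos[of 1] s by (simp add: g_def)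
qed

section \<open>Smooth cut-off functions\<close>

text \<open>The algebra of functions generated by B and the constants. By the product rule, it is
  closed under differentiation as soon as the derivatives of its generators lie in it.\<close>

inductive_set falg :: "('a \<Rightarrow> 'b::comm_ring_1) set \<Rightarrow> ('a \<Rightarrow> 'b) set" for B where
  base: "f \<in> B \<Longrightarrow> f \<in> falg B"
| const: "(\<lambda>_. c) \<in> falg B"
| add: "f \<in> falg B \<Longrightarrow> g \<in> falg B \<Longrightarrow> (\<lambda>x. f x + g x) \<in> falg B"
| mult: "f \<in> falg B \<Longrightarrow> g \<in> falg B \<Longrightarrow> (\<lambda>x. f x * g x) \<in> falg B"

text \<open>A coinductive encoding parallel to \<open>smooth_fun\<close>: a family closed under
  taking derivatives on U replaces derivatives of every order.\<close>

definition smooth_on :: "real set \<Rightarrow> (real \<Rightarrow> real) \<Rightarrow> bool" where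
  "smooth_on U f \<longleftrightarrow>
     (\<exists>F. f \<in> F \<and> (\<forall>g\<in>F. \<exists>g'\<in>F. \<forall>x\<in>U. (g has_real_derivative g' x) (at x)))"

lemma smooth_on_family:
  assumes "\<And>g. g \<in> F \<Longrightarrow> \<exists>g'\<in>F. \<forall>x\<in>U. (g has_real_derivative g' x) (at x)" "f \<in> F"
  shows "smooth_on U f"
  using assms unfolding smooth_on_def by blast

lemma smooth_on_derivative:
  assumes "smooth_on U f"
  obtains f' where "smooth_on U f'" "\<And>x. x \<in> U \<Longrightarrow> (f has_real_derivative f' x) (at x)"
  using assms unfolding smooth_on_def by metis

lemma smooth_on_derivative_Bex:
  assumes "smooth_on U f" "Collect (smooth_on U) \<subseteq> F"
  shows "\<exists>f'\<in>F. \<forall>x\<in>U. (f has_real_derivative f' x) (at x)"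
  using smooth_on_derivative[OF assms(1)] assms(2) by (metis mem_Collect_eq subsetD)

text \<open>The algebra itself is the witnessing family, so only the generators have to be
  differentiated.\<close>

lemma smooth_on_falg:
  assumes B: "\<And>g. g \<in> B \<Longrightarrow> \<exists>g'\<in>falg B. \<forall>x\<in>U. (g has_real_derivative g' x) (at x)"
    and "f \<in> falg B"
  shows "smooth_on U f"
proof (rule smooth_on_family[of "falg B"])
  fix g assume "g \<in> falg B"
  then show "\<exists>g'\<in>falg B. \<forall>x\<in>U. (g has_real_derivative g' x) (at x)"
  proof induction
    case (const c)
    show ?case by (rule bexI[OF _ falg.const[of 0]]) auto
  next
    case (add f g)
    then obtain f' g' where "f' \<in> falg B" "g' \<in> falg B"
      "\<forall>x\<in>U. (f has_real_derivative f' x) (at x)" "\<forall>x\<in>U. (g has_real_derivative g' x) (at x)" by blast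
    then show ?case by (intro bexI[OF _ falg.add[of f' _ g']]) (auto intro: DERIV_add)
  next
    case (mult f g)
    then obtain f' g' where *: "f' \<in> falg B" "g' \<in> falg B"
      "\<forall>x\<in>U. (f has_real_derivative f' x) (at x)" "\<forall>x\<in>U. (g has_real_derivative g' x) (at x)" by blast
    show ?case
    proof (rule bexI)
      show "\<forall>x\<in>U. ((\<lambda>x. f x * g x) has_real_derivative f' x * g x + g' x * f x) (at x)"
        using * by (auto intro: DERIV_mult)
      show "(\<lambda>x. f' x * g x + g' x * f x) \<in> falg B"
        by (intro falg.add falg.mult * mult.hyps)
    qed
  qed (rule B)
qed (rule assms)

lemma smooth_on_const [intro]: "smooth_on U (\<lambda>_. c)"
  by (rule smooth_on_falg[of "{}"]) (auto intro: falg.const)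

lemma smooth_on_ident [intro]: "smooth_on U (\<lambda>x. x)"
proof (rule smooth_on_falg[of "{\<lambda>x. x}"])
  fix g :: "real \<Rightarrow> real" assume "g \<in> {\<lambda>x. x}"
  then show "\<exists>g'\<in>falg {\<lambda>x. x}. \<forall>x\<in>U. (g has_real_derivative g' x) (at x)"
    by (intro bexI[OF _ falg.const[of 1]]) auto
qed (auto intro: falg.base)

lemma smooth_on_add [intro]:
  assumes "smooth_on U f" "smooth_on U g"
  shows "smooth_on U (\<lambda>x. f x + g x)"
proof (rule smooth_on_falg[of "Collect (smooth_on U)"])
  show "\<exists>g'\<in>falg (Collect (smooth_on U)). \<forall>x\<in>U. (h has_real_derivative g' x) (at x)"
    if "h \<in> Collect (smooth_on U)" for h
    using that by (intro smooth_on_derivative_Bex) (auto intro: falg.base)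
qed (use assms in \<open>simp add: falg.add falg.base\<close>)

lemma smooth_on_mult [intro]:
  assumes "smooth_on U f" "smooth_on U g"
  shows "smooth_on U (\<lambda>x. f x * g x)"
proof (rule smooth_on_falg[of "Collect (smooth_on U)"])
  show "\<exists>g'\<in>falg (Collect (smooth_on U)). \<forall>x\<in>U. (h has_real_derivative g' x) (at x)"
    if "h \<in> Collect (smooth_on U)" for h
    using that by (intro smooth_on_derivative_Bex) (auto intro: falg.base)
qed (use assms in \<open>simp add: falg.mult falg.base\<close>)

text \<open>Generators are the smooth functions on U and all k o f with k smooth on V. The chain
  rule yields (k' o f) f', a product of two generators, so no formula for higher derivatives of a
  composition arises.\<close>

lemma smooth_on_compose:
  assumes g: "smooth_on V g" and f: "smooth_on U f" and UV: "\<And>x. x \<in> U \<Longrightarrow> f x \<in> V"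
  shows "smooth_on U (\<lambda>x. g (f x))"
proof -
  define B where "B = Collect (smooth_on U) \<union> {\<lambda>x. h (f x) |h. smooth_on V h}"
  show ?thesis
  proof (rule smooth_on_falg[of B])
    show "(\<lambda>x. g (f x)) \<in> falg B" using g by (auto simp: B_def intro!: falg.base)
    fix h assume "h \<in> B"
    then consider "smooth_on U h" | k where "h = (\<lambda>x. k (f x))" "smooth_on V k"
      by (auto simp: B_def)
    then show "\<exists>g'\<in>falg B. \<forall>x\<in>U. (h has_real_derivative g' x) (at x)"
    proof cases
      case 1
      then show ?thesis by (intro smooth_on_derivative_Bex) (auto intro: falg.base simp: B_def)
    next
      case 2
      obtain f' where f': "smooth_on U f'" "\<And>x. x \<in> U \<Longrightarrow> (f has_real_derivative f' x) (at x)"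
        using smooth_on_derivative[OF f] by blast
      obtain k' where k': "smooth_on V k'" "\<And>x. x \<in> V \<Longrightarrow> (k has_real_derivative k' x) (at x)"
        using smooth_on_derivative[OF 2(2)] by blast
      show ?thesis
      proof (rule bexI)
        show "\<forall>x\<in>U. (h has_real_derivative k' (f x) * f' x) (at x)"
          unfolding 2(1) using f'(2) k'(2) UV by (auto intro: DERIV_chain2)
        show "(\<lambda>x. k' (f x) * f' x) \<in> falg B"
          using f'(1) k'(1) by (intro falg.mult falg.base) (auto simp: B_def)
      qed
    qed
  qed
qed

lemma smooth_on_inverse:
  assumes "0 \<notin> U"
  shows "smooth_on U inverse"
proof (rule smooth_on_falg[of "{inverse}"])
  fix g :: "real \<Rightarrow> real" assume "g \<in> {inverse}"
  then show "\<exists>g'\<in>falg {inverse}. \<forall>x\<in>U. (g has_real_derivative g' x) (at x)"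
    using assms
    by (intro bexI[of _ "\<lambda>x. - 1 * (inverse x * inverse x)"] falg.mult falg.const falg.base)
       (auto intro!: derivative_eq_intros)
qed (auto intro: falg.base)

lemma smooth_on_powr:
  assumes "U \<subseteq> {0<..}"
  shows "smooth_on U (\<lambda>x. x powr a)"
proof (rule smooth_on_family[of "range (\<lambda>(c, a) x. c * x powr a)"])
  show "(\<lambda>x. x powr a) \<in> range (\<lambda>(c, a) x. c * x powr a)"
    by (rule image_eqI[of _ _ "(1, a)"]) auto
  fix g assume "g \<in> range (\<lambda>(c, a) (x::real). c * x powr a)"
  then obtain c b where g: "g = (\<lambda>x. c * x powr b)" by auto
  have "\<forall>x\<in>U. (g has_real_derivative c * b * x powr (b - 1)) (at x)"
    unfolding g using assms by (auto intro!: derivative_eq_intros simp: powr_diff)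
  moreover have "(\<lambda>x. c * b * x powr (b - 1)) \<in> range (\<lambda>(c, a) x. c * x powr a)"
    by (rule image_eqI[of _ _ "(c * b, b - 1)"]) auto
  ultimately show "\<exists>g'\<in>range (\<lambda>(c, a) x. c * x powr a). \<forall>x\<in>U. (g has_real_derivative g' x) (at x)"
    by (intro bexI[of _ "\<lambda>x. c * b * x powr (b - 1)"]) auto
qed

lemma smooth_on_ln:
  assumes "U \<subseteq> {0<..}"
  shows "smooth_on U ln"
proof (rule smooth_on_family[of "insert ln (Collect (smooth_on U))"])
  fix g assume g: "g \<in> insert ln (Collect (smooth_on U))"
  have inv: "smooth_on U inverse" using assms by (intro smooth_on_inverse) auto
  have ln: "\<forall>x\<in>U. (ln has_real_derivative inverse x) (at x)" using assms by (auto intro: DERIV_ln)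
  show "\<exists>g'\<in>insert ln (Collect (smooth_on U)). \<forall>x\<in>U. (g has_real_derivative g' x) (at x)"
  proof (cases "g = ln")
    case True
    with inv ln show ?thesis by auto
  next
    case False
    with g have "smooth_on U g" by auto
    then show ?thesis by (intro smooth_on_derivative_Bex) auto
  qed
qed auto

text \<open>The witnessing family consists of the zero extensions of smooth functions that vanish on
  U - S. Differentiation preserves it: the extension is locally zero on the open set - S, so its
  derivative vanishes there too.\<close>

lemma smooth_on_extend_zero:
  assumes f: "smooth_on U f" and U: "open U" and S: "closed S" "S \<subseteq> U" "\<And>x. x \<in> U \<Longrightarrow> x \<notin> S \<Longrightarrow> f x = 0"
  shows "smooth_on UNIV (\<lambda>x. if x \<in> U then f x else 0)"
proof -
  define F where "F = {\<lambda>x. if x \<in> U then g x else 0 |g. smooth_on U g \<and> (\<forall>x\<in>U - S. g x = 0)}"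
  show ?thesis
  proof (rule smooth_on_family[of F])
    show "(\<lambda>x. if x \<in> U then f x else 0) \<in> F" unfolding F_def using f S(3) by blast
    fix h assume "h \<in> F"
    then obtain g where h: "h = (\<lambda>x. if x \<in> U then g x else 0)"
      and g: "smooth_on U g" "\<forall>x\<in>U - S. g x = 0" unfolding F_def by blast
    obtain g' where g': "smooth_on U g'" "\<And>x. x \<in> U \<Longrightarrow> (g has_real_derivative g' x) (at x)"
      using smooth_on_derivative[OF g(1)] by blast
    have h0: "h x = 0" if "x \<in> - S" for x using that g(2) by (auto simp: h)
    have d: "(h has_real_derivative (if x \<in> U then g' x else 0)) (at x)" for x
    proof (cases "x \<in> U")
      case True
      have "(h has_real_derivative g' x) (at x)"
        by (rule has_field_derivative_transform_within_open[OF g'(2)[OF True] U True]) (simp add: h)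
      then show ?thesis using True by simp
    next
      case False
      then have x: "x \<in> - S" using S(2) by auto
      have "(h has_real_derivative 0) (at x)"
        by (rule has_field_derivative_transform_within_open[OF DERIV_const[of 0] _ x])
           (use S(1) h0 in auto)
      then show ?thesis using False by simp
    qed
    have "g' x = 0" if "x \<in> U - S" for x
    proof -
      have "(h has_real_derivative 0) (at x)"
        by (rule has_field_derivative_transform_within_open[OF DERIV_const[of 0], of "- S"])
           (use S(1) h0 that in auto)
      then show ?thesis using DERIV_unique[OF d] that by fastforce
    qed
    then have "(\<lambda>x. if x \<in> U then g' x else 0) \<in> F" unfolding F_def using g'(1) by blast
    then show "\<exists>g'\<in>F. \<forall>x\<in>UNIV. (h has_real_derivative g' x) (at x)"
      by (rule bexI[rotated]) (use d in blast)
  qed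
qed

section \<open>The flat function exp(-1/x) and a smooth step\<close>

definition exp_bump :: "nat \<Rightarrow> real \<Rightarrow> real" where
  "exp_bump m x = (if x > 0 then inverse x ^ m * exp (- inverse x) else 0)"

lemma exp_bump_tendsto_0: "(exp_bump m \<longlongrightarrow> 0) (at_right 0)"
proof -
  have "((\<lambda>y::real. y ^ m / exp y) \<longlongrightarrow> 0) at_top" by (rule tendsto_power_div_exp_0)
  then have "((\<lambda>x::real. inverse x ^ m / exp (inverse x)) \<longlongrightarrow> 0) (at_right 0)"
    using filterlim_inverse_at_top_right by (rule filterlim_compose)
  moreover have "eventually (\<lambda>x::real. inverse x ^ m / exp (inverse x) = exp_bump m x) (at_right 0)"
    by (auto simp: eventually_at_filter exp_bump_def exp_minus divide_inverse)
  ultimately show ?thesis by (rule Lim_transform_eventually)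
qed

text \<open>The factor x^(-m) is what makes this family absorb all derivatives of exp(-1/x): each
  derivative is a combination of members with larger m.\<close>

lemma DERIV_exp_bump:
  "(exp_bump m has_real_derivative (exp_bump (m + 2) x - real m * exp_bump (m + 1) x)) (at x)"
proof -
  consider "x > 0" | "x < 0" | "x = 0" by linarith
  then show ?thesis
  proof cases
    case 1
    have "((\<lambda>x. inverse x ^ m * exp (- inverse x)) has_real_derivative
        real m * (- (inverse x * inverse x) * inverse x ^ (m - Suc 0)) * exp (- inverse x)
        + exp (- inverse x) * (inverse x * inverse x) * inverse x ^ m) (at x)"
      using 1 by (auto intro!: derivative_eq_intros)
    moreover have "real m * (- (inverse x * inverse x) * inverse x ^ (m - Suc 0)) * exp (- inverse x)
        + exp (- inverse x) * (inverse x * inverse x) * inverse x ^ m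
        = exp_bump (m + 2) x - real m * exp_bump (m + 1) x"
      using 1 by (cases m) (auto simp: exp_bump_def algebra_simps)
    ultimately have "((\<lambda>x. inverse x ^ m * exp (- inverse x)) has_real_derivative
        (exp_bump (m + 2) x - real m * exp_bump (m + 1) x)) (at x)"
      by simp
    then show ?thesis
      by (rule has_field_derivative_transform_within_open[of _ _ _ "{0<..}"]) (use 1 in \<open>auto simp: exp_bump_def\<close>)
  next
    case 2
    have "(exp_bump m has_real_derivative 0) (at x)"
      by (rule has_field_derivative_transform_within_open[OF DERIV_const[of 0], of "{..<0}"])
         (use 2 in \<open>auto simp: exp_bump_def\<close>)
    then show ?thesis using 2 by (simp add: exp_bump_def)
  next
    case 3
    \<comment> \<open>From the right, dividing by h only raises m by one, and every member of the
      family tends to 0 there.\<close>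
    have "((\<lambda>h. exp_bump m h / h) \<longlongrightarrow> 0) (at_right 0)"
      by (rule Lim_transform_eventually[OF exp_bump_tendsto_0[of "Suc m"]])
         (auto simp: eventually_at_filter exp_bump_def divide_inverse)
    moreover have "((\<lambda>h. exp_bump m h / h) \<longlongrightarrow> 0) (at_left 0)"
      by (rule Lim_transform_eventually[OF tendsto_const])
         (auto simp: eventually_at_filter exp_bump_def)
    ultimately have "((\<lambda>h. exp_bump m h / h) \<longlongrightarrow> 0) (at 0)" by (simp add: filterlim_split_at)
    then show ?thesis using 3 by (simp add: DERIV_def exp_bump_def)
  qed
qed

lemma smooth_on_exp_bump: "smooth_on U (exp_bump m)"
proof (rule smooth_on_falg[of "range exp_bump"])
  fix g assume "g \<in> range exp_bump"
  then obtain m where "g = exp_bump m" by auto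
  then show "\<exists>g'\<in>falg (range exp_bump). \<forall>x\<in>U. (g has_real_derivative g' x) (at x)"
    using DERIV_exp_bump[of m]
    by (intro bexI[of _ "\<lambda>x. exp_bump (m + 2) x + (- real m) * exp_bump (m + 1) x"]
        falg.add falg.mult falg.const falg.base) auto
qed (auto intro: falg.base)

definition smooth_step :: "real \<Rightarrow> real" where
  "smooth_step s = exp_bump 0 s * inverse (exp_bump 0 s + exp_bump 0 (1 - s))"

text \<open>The sum is positive because s and 1 - s are never both nonpositive; it is the
  denominator of \<open>smooth_step\<close>.\<close>

lemma exp_bump_0: "exp_bump 0 s \<ge> 0" "exp_bump 0 s + exp_bump 0 (1 - s) > 0"
  by (auto simp: exp_bump_def add_pos_pos)

lemma smooth_on_smooth_step: "smooth_on UNIV smooth_step"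
proof -
  have "smooth_on UNIV (\<lambda>s. 1 + (- 1) * s)" by (intro smooth_on_add smooth_on_mult smooth_on_const smooth_on_ident)
  from smooth_on_compose[OF smooth_on_exp_bump[of UNIV 0] this]
  have "smooth_on UNIV (\<lambda>s. exp_bump 0 (1 - s))" by simp
  then have "smooth_on UNIV (\<lambda>s. exp_bump 0 s + exp_bump 0 (1 - s))"
    by (intro smooth_on_add smooth_on_exp_bump)
  from smooth_on_compose[OF smooth_on_inverse this, of "{0<..}"]
  have "smooth_on UNIV (\<lambda>s. inverse (exp_bump 0 s + exp_bump 0 (1 - s)))"
    using exp_bump_0(2) by simp
  then show ?thesis unfolding smooth_step_def[abs_def] by (intro smooth_on_mult smooth_on_exp_bump)
qed

lemma smooth_step_bounds: "0 \<le> smooth_step s" "smooth_step s \<le> 1"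
  using exp_bump_0(1)[of s] exp_bump_0(1)[of "1 - s"] exp_bump_0(2)[of s]
  by (auto simp: smooth_step_def divide_inverse[symmetric] divide_le_eq)

lemma smooth_step_eq_0: "s \<le> 0 \<Longrightarrow> smooth_step s = 0"
  by (simp add: smooth_step_def exp_bump_def)

lemma smooth_step_eq_1: "s \<ge> 1 \<Longrightarrow> smooth_step s = 1"
  by (simp add: smooth_step_def exp_bump_def)

text \<open>Points with s <= 0 or s >= 1 are global minima or maxima of the step, so the derivative
  vanishes there, endpoints included; on [0, 1] it is bounded by compactness.\<close>

lemma smooth_step_derivative:
  obtains d c where "\<And>s. (smooth_step has_real_derivative d s) (at s)"
    "\<And>s. s \<le> 0 \<or> s \<ge> 1 \<Longrightarrow> d s = 0" "\<And>s. \<bar>d s\<bar> \<le> c"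
proof -
  obtain d where d: "smooth_on UNIV d" "\<And>s. (smooth_step has_real_derivative d s) (at s)"
    using smooth_on_derivative[OF smooth_on_smooth_step] by auto
  have d0: "d s = 0" if "s \<le> 0 \<or> s \<ge> 1" for s
  proof (cases "s \<le> 0")
    case True
    then show ?thesis
      using DERIV_local_min[OF d(2), of 1 s] smooth_step_bounds(1) by (simp add: smooth_step_eq_0)
  next
    case False
    then show ?thesis
      using DERIV_local_max[OF d(2), of 1 s] smooth_step_bounds(2) that by (simp add: smooth_step_eq_1)
  qed
  have "continuous_on {0..1} d"
    using smooth_on_derivative[OF d(1)]
    by (metis DERIV_isCont UNIV_I continuous_at_imp_continuous_on)
  then have "bounded (d ` {0..1})" by (intro compact_imp_bounded compact_continuous_image) auto
  then obtain c where "\<forall>y\<in>d ` {0..1}. norm y \<le> c" using bounded_iff by blast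
  then have c: "\<bar>d s\<bar> \<le> c" if "s \<in> {0..1}" for s using that by auto
  have "\<bar>d s\<bar> \<le> max c 0" for s
    using c[of s] d0[of s] by (cases "s \<in> {0..1}") auto
  with d(2) d0 show ?thesis by (rule that)
qed

section \<open>Smooth functions of |x'|^2 and |x''|^2\<close>

lemma pderivc_eq:
  assumes "(f has_derivative f') (at x)"
  shows "pderivc f j x = f' (axis j 1)"
  using frechet_derivative_at[OF assms] by (simp add: pderivc_def)

lemma smooth_fun_falg:
  fixes B :: "(real^'n::finite \<Rightarrow> complex) set"
  assumes B: "\<And>g. g \<in> B \<Longrightarrow> g differentiable_on UNIV \<and> (\<forall>j. pderivc g j \<in> falg B)"
    and f: "f \<in> falg B"
  shows "smooth_fun f"
  unfolding smooth_fun_def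
proof (rule exI[of _ "falg B"], intro conjI ballI)
  fix g assume "g \<in> falg B"
  then have "g differentiable_on UNIV \<and> (\<forall>j. pderivc g j \<in> falg B)"
  proof induction
    case (base f)
    then show ?case by (rule B)
  next
    case (const c)
    have "pderivc (\<lambda>_. c) j = (\<lambda>_. 0)" for j :: 'n
      by (rule ext) (simp add: pderivc_eq[OF has_derivative_const])
    then show ?case by (simp add: falg.const)
  next
    case (add f g)
    then have d: "(f has_derivative frechet_derivative f (at x)) (at x)"
        "(g has_derivative frechet_derivative g (at x)) (at x)" for x
      by (simp_all add: differentiable_on_def frechet_derivative_works[symmetric])
    have "pderivc (\<lambda>x. f x + g x) j = (\<lambda>x. pderivc f j x + pderivc g j x)" for j
      by (rule ext) (simp add: pderivc_eq[OF has_derivative_add[OF d]] pderivc_def)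
    with add show ?case by (auto intro: falg.add)
  next
    case (mult f g)
    then have d: "(f has_derivative frechet_derivative f (at x)) (at x)"
        "(g has_derivative frechet_derivative g (at x)) (at x)" for x
      by (simp_all add: differentiable_on_def frechet_derivative_works[symmetric])
    have "pderivc (\<lambda>x. f x * g x) j = (\<lambda>x. f x * pderivc g j x + pderivc f j x * g x)" for j
      by (rule ext) (simp add: pderivc_eq[OF has_derivative_mult[OF d]] pderivc_def)
    moreover have "(\<lambda>x. f x * g x) differentiable_on UNIV"
      using has_derivative_mult[OF d] by (auto simp: differentiable_on_def differentiable_def)
    ultimately show ?case using mult by (auto intro!: falg.add falg.mult)
  qed
  then show "g differentiable_on UNIV" "\<forall>j. pderivc g j \<in> falg B" by auto
qed (rule f)

lemma sum_axis:
  fixes x :: "real^'n::finite"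
  shows "(\<Sum>i\<in>K. 2 * (x$i * axis j 1 $ i)) = (if j \<in> K then 2 * x$j else 0)"
  by (simp add: axis_def if_distrib[of "\<lambda>z. _ * z"] cong: if_cong)

lemma has_derivative_normK_power2_chain:
  fixes x :: "real^'n::finite"
  assumes "(h has_real_derivative D) (at ((normK K x)\<^sup>2))"
  shows "((\<lambda>x. h ((normK K x)\<^sup>2)) has_derivative (\<lambda>v. D * (\<Sum>i\<in>K. 2 * (x$i * v$i)))) (at x)"
  using has_derivative_compose[OF has_derivative_normK_power2, of h "(*) D"] assms
  by (simp add: has_field_derivative_def)

text \<open>Squared norms are polynomials, hence smooth even where the norm vanishes. The partial
  derivative of h(|x_A|^2) is 2 x_j h'(|x_A|^2) for j in A and 0 otherwise, so coordinates and such
  radial functions suffice as generators.\<close>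

lemma smooth_fun_normK_product:
  assumes G: "smooth_on UNIV G" and H: "smooth_on UNIV H"
  shows "smooth_fun (\<lambda>x::real^'n::finite. complex_of_real (G ((normK K x)\<^sup>2) * H ((normK L x)\<^sup>2)))"
proof -
  define B :: "(real^'n \<Rightarrow> complex) set" where
    "B = range (\<lambda>i x. of_real (x$i)) \<union> {\<lambda>x. of_real (h ((normK A x)\<^sup>2)) |h A. smooth_on UNIV h}"
  have coord: "(\<lambda>x. of_real (x$i)) \<in> falg B" for i by (rule falg.base) (auto simp: B_def)
  have radial: "(\<lambda>x. of_real (h ((normK A x)\<^sup>2))) \<in> falg B" if "smooth_on UNIV h" for h A
    by (rule falg.base) (use that in \<open>auto simp: B_def\<close>)
  show ?thesis
  proof (rule smooth_fun_falg[of B])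
    show "(\<lambda>x. complex_of_real (G ((normK K x)\<^sup>2) * H ((normK L x)\<^sup>2))) \<in> falg B"
      using falg.mult[OF radial[OF G] radial[OF H]] by simp
    fix g assume "g \<in> B"
    then consider i where "g = (\<lambda>x. of_real (x$i))"
      | h A where "smooth_on UNIV h" "g = (\<lambda>x. of_real (h ((normK A x)\<^sup>2)))"
      unfolding B_def by blast
    then show "g differentiable_on UNIV \<and> (\<forall>j. pderivc g j \<in> falg B)"
    proof cases
      case 1
      have d: "(g has_derivative (\<lambda>h. of_real (h$i))) (at x)" for x
        unfolding 1 by (rule has_derivative_of_real[OF has_derivative_component])
      have "pderivc g j = (\<lambda>_. of_real (axis j 1 $ i))" for j
        by (rule ext) (rule pderivc_eq[OF d])
      then show ?thesis using d
        by (auto simp: differentiable_on_def differentiable_def intro: falg.const)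
    next
      case 2
      obtain h' where h': "smooth_on UNIV h'" "\<And>y. (h has_real_derivative h' y) (at y)"
        using smooth_on_derivative[OF 2(1)] by auto
      have d: "(g has_derivative (\<lambda>v. of_real (h' ((normK A x)\<^sup>2) * (\<Sum>i\<in>A. 2 * (x$i * v$i))))) (at x)" for x
        unfolding 2(2) by (rule has_derivative_of_real[OF has_derivative_normK_power2_chain[OF h'(2)]])
      have "pderivc g j = (\<lambda>x. of_real (h' ((normK A x)\<^sup>2)) * (of_real (if j \<in> A then 2 else 0) * of_real (x$j)))" for j
        by (rule ext) (simp add: pderivc_eq[OF d] sum_axis)
      then show ?thesis using d radial[OF h'(1)] coord
        by (auto simp: differentiable_on_def differentiable_def intro!: falg.mult falg.const)
    qed
  qed
qed

lemma norm_power2_normK: "(norm x)\<^sup>2 = (normK K x)\<^sup>2 + (normK (- K) x)\<^sup>2"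
proof -
  have "(norm x)\<^sup>2 = (\<Sum>i\<in>UNIV. (x$i)\<^sup>2)" by (simp add: norm_vec_def L2_set_def sum_nonneg)
  also have "\<dots> = (\<Sum>i\<in>K. (x$i)\<^sup>2) + (\<Sum>i\<in>-K. (x$i)\<^sup>2)"
    using sum.union_disjoint[of K "- K" "\<lambda>i. (x$i)\<^sup>2"] by simp
  finally show ?thesis by (simp add: normK_power2)
qed

text \<open>The bounds a > 0 and b < R^2 keep the support away from x' = 0 and from |x'| = R, and c
  bounds it in x''.\<close>

lemma test_fun_normK_product:
  fixes K :: "'n::finite set"
  assumes G: "smooth_on UNIV G" "\<And>y. G y \<noteq> 0 \<Longrightarrow> a \<le> y \<and> y \<le> b" "0 < a" "b < R\<^sup>2"
    and H: "smooth_on UNIV H" "\<And>z. H z \<noteq> 0 \<Longrightarrow> z \<le> c"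
    and R: "R > 0"
  shows "test_fun K R (\<lambda>x. complex_of_real (G ((normK K x)\<^sup>2) * H ((normK (- K) x)\<^sup>2)))"
proof -
  let ?f = "\<lambda>x. complex_of_real (G ((normK K x)\<^sup>2) * H ((normK (- K) x)\<^sup>2))"
  define C where "C = {x. a \<le> (normK K x)\<^sup>2 \<and> (normK K x)\<^sup>2 \<le> b \<and> (normK (- K) x)\<^sup>2 \<le> c}"
  have "closed C"
    unfolding C_def by (intro closed_Collect_conj closed_Collect_le continuous_intros)
  moreover have "bounded C"
  proof (rule boundedI)
    fix x assume "x \<in> C"
    then have "(norm x)\<^sup>2 \<le> b + c" by (auto simp: C_def norm_power2_normK[of x K])
    then show "norm x \<le> sqrt (b + c)" by (rule real_le_rsqrt)
  qed
  moreover have "{x. ?f x \<noteq> 0} \<subseteq> C" using G(2) H(2) by (auto simp: C_def)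
  ultimately have "compact (closure {x. ?f x \<noteq> 0})" and cl: "closure {x. ?f x \<noteq> 0} \<subseteq> C"
    by (auto simp: compact_eq_bounded_closed closure_minimal intro: bounded_subset bounded_closure)
  moreover have "C \<subseteq> OmegaR K R"
  proof
    fix x assume "x \<in> C"
    then have "0 < (normK K x)\<^sup>2" "(normK K x)\<^sup>2 < R\<^sup>2" using G by (auto simp: C_def)
    then show "x \<in> OmegaR K R"
      using normK_nonneg[of K x] R by (auto simp: OmegaR_def power2_less_imp_less less_le)
  qed
  ultimately show ?thesis
    unfolding test_fun_def using smooth_fun_normK_product[OF G(1) H(1)] by blast
qed

text \<open>H depends on the coordinates outside K only, so the Euler field treats it as a
  constant.\<close>

lemma xgrad_normK_product:
  fixes K :: "'n::finite set"
  assumes G: "(G has_real_derivative D) (at ((normK K x)\<^sup>2))"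
    and H: "(H has_real_derivative D') (at ((normK (- K) x)\<^sup>2))"
  shows "xgrad K (\<lambda>x. complex_of_real (G ((normK K x)\<^sup>2) * H ((normK (- K) x)\<^sup>2))) x
     = of_real (2 * (normK K x)\<^sup>2 * D * H ((normK (- K) x)\<^sup>2))"
proof -
  note d = has_derivative_of_real[OF has_derivative_mult[OF
      has_derivative_normK_power2_chain[OF G] has_derivative_normK_power2_chain[OF H]], where 'a = complex]
  have "pderivc (\<lambda>x. complex_of_real (G ((normK K x)\<^sup>2) * H ((normK (- K) x)\<^sup>2))) j x
      = of_real (D * (2 * x$j) * H ((normK (- K) x)\<^sup>2))" if "j \<in> K" for j
    by (rule trans[OF pderivc_eq[OF d]]) (simp add: sum_axis that)
  then have "xgrad K (\<lambda>x. complex_of_real (G ((normK K x)\<^sup>2) * H ((normK (- K) x)\<^sup>2))) x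
      = (\<Sum>j\<in>K. of_real (x$j * (D * (2 * x$j) * H ((normK (- K) x)\<^sup>2))))"
    unfolding xgrad_def by (intro sum.cong refl) simp
  also have "\<dots> = of_real (\<Sum>j\<in>K. 2 * D * H ((normK (- K) x)\<^sup>2) * (x$j)\<^sup>2)"
    by (simp add: power2_eq_square mult_ac)
  also have "\<dots> = of_real (2 * D * H ((normK (- K) x)\<^sup>2) * (normK K x)\<^sup>2)"
    unfolding normK_power2[of K] by (simp only: sum_distrib_left)
  finally show ?thesis by (simp add: mult_ac)
qed

section \<open>Sharpness of the constant\<close>

definition cyl :: "'n::finite set \<Rightarrow> real \<Rightarrow> real \<Rightarrow> (real^'n) set" where
  "cyl K \<kappa> \<rho> = {x. normK K x < \<rho> \<and> (normK (- K) x)\<^sup>2 \<le> \<kappa>}"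

lemma lmeasurable_cyl: "cyl K \<kappa> \<rho> \<in> lmeasurable"
proof (rule bounded_set_imp_lmeasurable)
  show "bounded (cyl K \<kappa> \<rho>)"
  proof (rule boundedI)
    fix x assume x: "x \<in> cyl K \<kappa> \<rho>"
    then have "(normK K x)\<^sup>2 \<le> \<rho>\<^sup>2"
      using normK_nonneg[of K x] by (intro power_mono) (auto simp: cyl_def)
    with x have "(norm x)\<^sup>2 \<le> \<rho>\<^sup>2 + \<kappa>" by (auto simp: cyl_def norm_power2_normK[of x K])
    then show "norm x \<le> sqrt (\<rho>\<^sup>2 + \<kappa>)" by (rule real_le_rsqrt)
  qed
  have "cyl K \<kappa> \<rho> = {x. normK K x < \<rho>} \<inter> {x. (normK (- K) x)\<^sup>2 \<le> \<kappa>}"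
    by (auto simp: cyl_def)
  moreover have "open {x. normK K x < \<rho>}" by (intro open_Collect_less continuous_intros)
  moreover have "closed {x. (normK (- K) x)\<^sup>2 \<le> \<kappa>}" by (intro closed_Collect_le continuous_intros)
  ultimately show "cyl K \<kappa> \<rho> \<in> sets lebesgue"
    by (simp add: sets.Int borel_open borel_closed sets_completionI_sets)
qed

lemma measure_cyl_pos:
  assumes "\<rho> > 0" "\<kappa> > 0"
  shows "measure lebesgue (cyl K \<kappa> \<rho>) > 0"
proof -
  let ?O = "{x. normK K x < \<rho> \<and> (normK (- K) x)\<^sup>2 < \<kappa>}"
  have "open ?O" by (intro open_Collect_conj open_Collect_less continuous_intros)
  moreover have "0 \<in> ?O" using assms by (simp add: normK_def)
  ultimately have "\<not> negligible ?O" using open_not_negligible by blast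
  moreover have "?O \<subseteq> cyl K \<kappa> \<rho>" by (auto simp: cyl_def)
  ultimately have "\<not> negligible (cyl K \<kappa> \<rho>)" using negligible_subset by blast
  then have "measure lebesgue (cyl K \<kappa> \<rho>) \<noteq> 0"
    using lmeasurable_cyl negligible_iff_measure by blast
  then show ?thesis by (simp add: less_le)
qed

text \<open>The stretch by sigma in the coordinates of K has determinant sigma^(card K) and leaves
  x'' alone.\<close>

lemma measure_cyl_scale:
  assumes "\<sigma> > 0"
  shows "measure lebesgue (cyl K \<kappa> (\<sigma> * \<rho>)) = \<sigma> ^ card K * measure lebesgue (cyl K \<kappa> \<rho>)"
proof -
  define m where "m i = (if i \<in> K then \<sigma> else 1)" for i
  let ?T = "\<lambda>x. \<chi> i. m i * x$i"
  have nT: "normK K (?T x) = \<sigma> * normK K x" "normK (- K) (?T x) = normK (- K) x" for x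
    using assms
    by (simp_all add: normK_def m_def power_mult_distrib real_sqrt_mult flip: sum_distrib_left)
  have "cyl K \<kappa> (\<sigma> * \<rho>) = ?T ` cyl K \<kappa> \<rho>"
  proof (intro equalityI subsetI)
    fix y assume y: "y \<in> cyl K \<kappa> (\<sigma> * \<rho>)"
    define x where "x = (\<chi> i. inverse (m i) * y$i)"
    have yx: "y = ?T x" using assms by (simp add: x_def m_def vec_eq_iff)
    then have "x \<in> cyl K \<kappa> \<rho>" using y assms nT[of x] by (simp add: cyl_def)
    then show "y \<in> ?T ` cyl K \<kappa> \<rho>" using yx by blast
  qed (use assms nT in \<open>auto simp: cyl_def\<close>)
  moreover have "\<bar>prod m UNIV\<bar> = \<sigma> ^ card K"
    using assms by (simp add: m_def prod.If_cases)
  ultimately show ?thesis using measure_stretch[OF lmeasurable_cyl, of m] by simp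
qed

text \<open>A unit interval in the variable ln L. The shells approach |x'| = R as m grows, and
  half-open ends make them disjoint.\<close>

definition shell :: "'n::finite set \<Rightarrow> real \<Rightarrow> real \<Rightarrow> nat \<Rightarrow> (real^'n) set" where
  "shell K R \<kappa> m = {x \<in> OmegaR K R. exp (- real m - 1) < Lg K R x \<and> Lg K R x \<le> exp (- real m)
      \<and> (normK (- K) x)\<^sup>2 \<le> \<kappa>}"

text \<open>L > e^a is equivalent to |x'| < R exp(-e^a), so a shell is a difference of two
  cylinders.\<close>

lemma shell_eq:
  assumes "R > 0"
  shows "shell K R \<kappa> m = cyl K \<kappa> (exp (- exp (- real m - 1)) * R) - cyl K \<kappa> (exp (- exp (- real m)) * R)"
proof -
  have L: "(exp a < Lg K R x) = (normK K x < exp (- exp a) * R)" if "normK K x > 0" for x a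
  proof -
    have "exp a < ln (R / normK K x) \<longleftrightarrow> exp (exp a) < R / normK K x"
      using that assms by (simp add: ln_less_cancel_iff[of "exp (exp a)", symmetric] del: ln_less_cancel_iff)
    then show ?thesis using that by (simp add: Lg_def exp_minus field_simps)
  qed
  have le: "exp (- exp a) * R < R" for a using assms by simp
  show ?thesis
  proof (intro equalityI subsetI)
    fix x assume "x \<in> shell K R \<kappa> m"
    then show "x \<in> cyl K \<kappa> (exp (- exp (- real m - 1)) * R) - cyl K \<kappa> (exp (- exp (- real m)) * R)"
      using L[of x "- real m - 1"] L[of x "- real m"] by (auto simp: shell_def cyl_def OmegaR_def)
  next
    fix x assume x: "x \<in> cyl K \<kappa> (exp (- exp (- real m - 1)) * R) - cyl K \<kappa> (exp (- exp (- real m)) * R)"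
    then have "0 < exp (- exp (- real m)) * R" "exp (- exp (- real m)) * R \<le> normK K x"
      using assms by (auto simp: cyl_def)
    then have "normK K x > 0" by linarith
    moreover have "normK K x < R" using x le[of "- real m - 1"] by (auto simp: cyl_def)
    ultimately show "x \<in> shell K R \<kappa> m"
      using x L[of x "- real m - 1"] L[of x "- real m"] by (auto simp: shell_def cyl_def OmegaR_def)
  qed
qed

lemma lmeasurable_shell: "R > 0 \<Longrightarrow> shell K R \<kappa> m \<in> lmeasurable"
  unfolding shell_eq by (intro fmeasurable.Diff lmeasurable_cyl)

lemma exp_minus_diff_bounds:
  fixes x y :: real
  assumes "x \<le> y"
  shows "exp (- x) - exp (- y) \<le> exp (- x) * (y - x)" "exp (- y) * (y - x) \<le> exp (- x) - exp (- y)"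
proof -
  have "exp (- x) * (1 + (x - y)) \<le> exp (- x) * exp (x - y)"
    by (intro mult_left_mono exp_ge_add_one_self) simp
  then show "exp (- x) - exp (- y) \<le> exp (- x) * (y - x)"
    by (simp add: algebra_simps flip: exp_add)
  have "exp (- y) * (1 + (y - x)) \<le> exp (- y) * exp (y - x)"
    by (intro mult_left_mono exp_ge_add_one_self) simp
  then show "exp (- y) * (y - x) \<le> exp (- x) - exp (- y)"
    by (simp add: algebra_simps flip: exp_add)
qed

text \<open>By scaling, the measure is V (exp(-k t1) - exp(-k t2)) with t2 = e^(-m) and t1 = t2 / e,
  which is comparable to V k (t2 - t1). The resulting e^(-m) balances the factor 1 / L, of order e^m
  on the shell. The loss exp(-k) in the lower bound comes from k t2 <= k.\<close>

lemma measure_shell_bounds: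
  fixes K :: "'n::finite set" and R \<kappa> :: real and m :: nat
  assumes R: "R > 0"
  defines "V \<equiv> measure lebesgue (cyl K \<kappa> R)" and "k \<equiv> real (card K)"
  shows "measure lebesgue (shell K R \<kappa> m) \<le> V * k * exp (- real m)"
    and "V * exp (- k) * k * (1 - exp (- 1)) * exp (- real m) \<le> measure lebesgue (shell K R \<kappa> m)"
proof -
  define t1 t2 where "t1 = exp (- real m - 1)" and "t2 = exp (- real m)"
  have t: "0 < t1" "t1 \<le> t2" "t2 \<le> 1" by (auto simp: t1_def t2_def)
  have V: "V \<ge> 0" and k: "k \<ge> 0" by (auto simp: V_def k_def)
  have cyl: "measure lebesgue (cyl K \<kappa> (exp (- t) * R)) = exp (- (k * t)) * V" for t
    using measure_cyl_scale[of "exp (- t)" K \<kappa> R]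
    by (simp add: V_def k_def exp_of_nat_mult[symmetric])
  have "cyl K \<kappa> (exp (- t2) * R) \<subseteq> cyl K \<kappa> (exp (- t1) * R)"
  proof -
    have "exp (- t2) * R \<le> exp (- t1) * R" using t R by simp
    then show ?thesis by (auto simp: cyl_def)
  qed
  then have eq: "measure lebesgue (shell K R \<kappa> m) = V * (exp (- (k * t1)) - exp (- (k * t2)))"
    unfolding shell_eq[OF R] t1_def[symmetric] t2_def[symmetric]
    by (subst measurable_measure_Diff) (simp_all add: cyl lmeasurable_cyl fmeasurableD right_diff_distrib mult.commute[of V])
  have kt: "k * t1 \<le> k * t2" "k * t2 \<le> k" using t k by (auto intro: mult_left_mono mult_left_le)
  have "exp (- (k * t1)) - exp (- (k * t2)) \<le> exp (- (k * t1)) * (k * t2 - k * t1)"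
    by (rule exp_minus_diff_bounds(1)[OF kt(1)])
  also have "\<dots> \<le> 1 * (k * t2)"
    using t k kt by (intro mult_mono) auto
  finally have "V * (exp (- (k * t1)) - exp (- (k * t2))) \<le> V * (k * t2)"
    using V by (intro mult_left_mono) auto
  then show "measure lebesgue (shell K R \<kappa> m) \<le> V * k * exp (- real m)"
    by (simp add: eq t2_def mult_ac)
  have "exp (- k) * (k * t2 - k * t1) \<le> exp (- (k * t2)) * (k * t2 - k * t1)"
    using kt by (intro mult_right_mono) auto
  also have "\<dots> \<le> exp (- (k * t1)) - exp (- (k * t2))"
    by (rule exp_minus_diff_bounds(2)[OF kt(1)])
  finally have "V * (exp (- k) * (k * t2 - k * t1)) \<le> V * (exp (- (k * t1)) - exp (- (k * t2)))"
    using V by (intro mult_left_mono) auto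
  moreover have "t1 = exp (- 1) * t2" by (simp add: t1_def t2_def flip: exp_add)
  ultimately show "V * exp (- k) * k * (1 - exp (- 1)) * exp (- real m) \<le> measure lebesgue (shell K R \<kappa> m)"
    by (simp add: eq t2_def algebra_simps)
qed

text \<open>As a function of y = |x'|^2, L is ln R - (ln y) / 2, so a function of L fits the product
  form above. The Euler field sends L to -1, which gives the sign in the last clause.\<close>

lemma log_radial_test_fun:
  fixes K :: "'n::finite set"
  assumes R: "R > 0"
    and g: "smooth_on {0<..} g" "\<And>t. t > 0 \<Longrightarrow> (g has_real_derivative g' t) (at t)"
    and supp: "\<And>t. t > 0 \<Longrightarrow> g t \<noteq> 0 \<Longrightarrow> t1 \<le> t \<and> t \<le> t2" "0 < t1"
    and H: "smooth_on UNIV H" "\<And>z. H z \<noteq> 0 \<Longrightarrow> z \<le> c"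
  obtains f where "test_fun K R f"
    and "\<And>x. x \<in> OmegaR K R \<Longrightarrow> f x = of_real (g (Lg K R x) * H ((normK (- K) x)\<^sup>2))"
    and "\<And>x. x \<in> OmegaR K R \<Longrightarrow> xgrad K f x = of_real (- (g' (Lg K R x) * H ((normK (- K) x)\<^sup>2)))"
proof -
  define l where "l y = ln R + (- 1/2) * ln y" for y
  define U where "U = {0<..<R\<^sup>2}"
  \<comment> \<open>The range t1 <= L <= t2 rewritten as a <= |x'|^2 <= b; t1 > 0 yields b <
    R^2.\<close>
  define a where "a = exp (2 * (ln R - t2))"
  define b where "b = exp (2 * (ln R - t1))"
  define G where "G y = (if y \<in> U then g (l y) else 0)" for y
  have R2: "R\<^sup>2 = exp (2 * ln R)" using R by (simp add: exp_double)
  have l_exp: "l y = ln R - u" if "y = exp (2 * u)" for y u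
    using that by (simp add: l_def)
  have lpos: "l y > 0" if "y \<in> U" for y
  proof -
    have "0 < y" "y < R\<^sup>2" using that by (auto simp: U_def)
    then have "ln y < ln (R\<^sup>2)" using R by (subst ln_less_cancel_iff) auto
    then show ?thesis using R by (simp add: l_def ln_realpow)
  qed
  have lL: "(normK K x)\<^sup>2 \<in> U" "l ((normK K x)\<^sup>2) = Lg K R x" if "x \<in> OmegaR K R" for x
  proof -
    have r: "0 < normK K x" "normK K x < R" using OmegaR_D[OF that] by auto
    then show "(normK K x)\<^sup>2 \<in> U" by (auto simp: U_def power_strict_mono)
    show "l ((normK K x)\<^sup>2) = Lg K R x" using r R by (simp add: l_def Lg_def ln_div ln_realpow)
  qed
  have smooth_gl: "smooth_on U (\<lambda>y. g (l y))"
  proof (rule smooth_on_compose[OF g(1)])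
    show "smooth_on U l" unfolding l_def[abs_def]
      by (intro smooth_on_add smooth_on_mult smooth_on_const smooth_on_ln) (auto simp: U_def)
  qed (use lpos in auto)
  have G_supp: "a \<le> y \<and> y \<le> b" if "G y \<noteq> 0" for y
  proof -
    from that have y: "y \<in> U" "g (l y) \<noteq> 0" by (auto simp: G_def split: if_splits)
    then have "t1 \<le> l y" "l y \<le> t2" using supp(1)[OF lpos] by auto
    then have "2 * (ln R - t2) \<le> ln y" "ln y \<le> 2 * (ln R - t1)" by (auto simp: l_def)
    then have "exp (2 * (ln R - t2)) \<le> exp (ln y)" "exp (ln y) \<le> exp (2 * (ln R - t1))"
      by (simp_all only: exp_le_cancel_iff)
    moreover have "exp (ln y) = y" using y(1) by (simp add: U_def)
    ultimately show ?thesis by (simp add: a_def b_def)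
  qed
  have ab: "0 < a" "b < R\<^sup>2" using supp(2) by (auto simp: a_def b_def R2)
  have "smooth_on UNIV G" unfolding G_def[abs_def]
  proof (rule smooth_on_extend_zero[OF smooth_gl, of "{a..b}"])
    show "g (l y) = 0" if "y \<in> U" "y \<notin> {a..b}" for y
      using G_supp[of y] that by (auto simp: G_def)
  qed (use ab in \<open>auto simp: U_def\<close>)
  from test_fun_normK_product[OF this G_supp ab H R]
  have "test_fun K R (\<lambda>x. complex_of_real (G ((normK K x)\<^sup>2) * H ((normK (- K) x)\<^sup>2)))" by blast
  then show thesis
  proof (rule that)
    fix x assume x: "x \<in> OmegaR K R"
    define y where "y = (normK K x)\<^sup>2"
    have y: "y \<in> U" "l y = Lg K R x" "y > 0" using lL[OF x] by (auto simp: y_def U_def)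
    show "complex_of_real (G ((normK K x)\<^sup>2) * H ((normK (- K) x)\<^sup>2))
        = of_real (g (Lg K R x) * H ((normK (- K) x)\<^sup>2))"
      using y by (simp add: G_def y_def)
    have "(l has_real_derivative (- 1/2) * (1 / y)) (at y)"
      unfolding l_def using y(3) by (auto intro!: derivative_eq_intros)
    from DERIV_chain2[OF g(2)[OF lpos[OF y(1)]] this]
    have "((\<lambda>y. g (l y)) has_real_derivative g' (Lg K R x) * ((- 1/2) * (1 / y))) (at y)"
      using y(2) by simp
    then have "(G has_real_derivative g' (Lg K R x) * ((- 1/2) * (1 / y))) (at y)"
      by (rule has_field_derivative_transform_within_open[of _ _ _ U]) (use y in \<open>auto simp: G_def U_def\<close>)
    moreover obtain D' where "(H has_real_derivative D') (at ((normK (- K) x)\<^sup>2))"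
      using smooth_on_derivative[OF H(1)] by auto
    ultimately show "xgrad K (\<lambda>x. complex_of_real (G ((normK K x)\<^sup>2) * H ((normK (- K) x)\<^sup>2))) x
        = of_real (- (g' (Lg K R x) * H ((normK (- K) x)\<^sup>2)))"
      using y(3) unfolding y_def by (subst xgrad_normK_product) auto
  qed
qed

lemma integral_indicator_shell:
  fixes K :: "'n::finite set"
  assumes "R > 0"
  shows "integrable (lebesgue_on (OmegaR K R)) (indicator (shell K R \<kappa> m) :: _ \<Rightarrow> real)"
    and "integral\<^sup>L (lebesgue_on (OmegaR K R)) (indicator (shell K R \<kappa> m) :: _ \<Rightarrow> real)
      = measure lebesgue (shell K R \<kappa> m)"
proof -
  let ?S = "shell K R \<kappa> m" and ?\<Omega> = "OmegaR K R"
  have sub: "?S \<subseteq> ?\<Omega>" by (auto simp: shell_def)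
  have \<Omega>: "?\<Omega> \<inter> space lebesgue \<in> sets lebesgue" using open_OmegaR[of K R] by auto
  have eq: "(\<lambda>x. indicator ?\<Omega> x *\<^sub>R (indicator ?S x :: real)) = indicator ?S"
    using sub by (intro ext) (auto simp: indicator_def)
  have int: "integrable lebesgue (indicator ?S :: _ \<Rightarrow> real)"
    using lmeasurable_shell[OF assms] lmeasurable_iff_integrable by blast
  then show "integrable (lebesgue_on ?\<Omega>) (indicator ?S :: _ \<Rightarrow> real)"
    by (subst integrable_restrict_space[OF \<Omega>]) (simp only: set_integrable_def eq)
  show "integral\<^sup>L (lebesgue_on ?\<Omega>) (indicator ?S :: _ \<Rightarrow> real) = measure lebesgue ?S"
    unfolding integral_restrict_space[OF \<Omega>] eq by simp
qed

lemma disjoint_shells: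
  assumes "x \<in> shell K R \<kappa> m" "x \<in> shell K R \<kappa> n"
  shows "m = n"
proof -
  have "exp (- real m - 1) < exp (- real n)" "exp (- real n - 1) < exp (- real m)"
    using assms unfolding shell_def by (auto intro: less_le_trans simp del: exp_less_cancel_iff)
  then show ?thesis by simp
qed

text \<open>In the variable \<open>s = ln L\<close> the two integrands of a function \<open>L^b \<phi>(s) H(|x''|^2)\<close>, where
  \<open>b = (\<beta>+p)/p\<close>, are \<open>|\<phi>|^p\<close> and \<open>|b \<phi> + \<phi>'|^p\<close> times the same weight.\<close>

lemma log_radial_integrands:
  fixes L r h u \<beta> p \<gamma> :: real
  assumes "L > 0" "p > 1" "h \<ge> 0"
  shows "cmod (of_real (L powr ((\<beta> + p) / p) * u * h)) powr p / (r powr \<gamma> * L powr (\<beta> + p + 1))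
      = \<bar>u\<bar> powr p * (h powr p / (r powr \<gamma> * L))"
    and "cmod (of_real (- (L powr ((\<beta> + p) / p - 1) * u * h))) powr p / (r powr \<gamma> * L powr (\<beta> + 1))
      = \<bar>u\<bar> powr p * (h powr p / (r powr \<gamma> * L))"
proof -
  have 1: "(L powr ((\<beta> + p) / p)) powr p = L powr (\<beta> + p)" using assms by (simp add: powr_powr)
  define q where "q = L powr ((\<beta> + p) / p - 1)"
  have 2: "q powr p = L powr \<beta>" "q > 0"
    using assms by (simp_all add: q_def powr_powr left_diff_distrib)
  have 3: "L powr (\<beta> + p + 1) = L powr (\<beta> + p) * L" and 4: "L powr (\<beta> + 1) = L powr \<beta> * L"
    using assms by (simp_all add: powr_add)
  show "cmod (of_real (L powr ((\<beta> + p) / p) * u * h)) powr p / (r powr \<gamma> * L powr (\<beta> + p + 1))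
      = \<bar>u\<bar> powr p * (h powr p / (r powr \<gamma> * L))"
    using assms unfolding norm_of_real abs_mult 3
    by (simp add: powr_mult 1 field_simps)
  show "cmod (of_real (- (L powr ((\<beta> + p) / p - 1) * u * h))) powr p / (r powr \<gamma> * L powr (\<beta> + 1))
      = \<bar>u\<bar> powr p * (h powr p / (r powr \<gamma> * L))"
    using assms unfolding norm_of_real abs_minus_cancel abs_mult 4 q_def[symmetric]
    by (simp add: powr_mult 2 abs_of_pos field_simps)
qed

text \<open>Since |x'| = R e^(-L), the power is R^(-gamma) e^(gamma L) with 0 < L <= 1.\<close>

lemma normK_powr_bounds:
  assumes x: "x \<in> OmegaR K R" and L: "Lg K R x \<le> 1"
  shows "1 / normK K x powr \<gamma> \<le> R powr (- \<gamma>) * exp \<bar>\<gamma>\<bar>"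
    and "R powr (- \<gamma>) * exp (- \<bar>\<gamma>\<bar>) \<le> 1 / normK K x powr \<gamma>"
proof -
  have r: "0 < normK K x" "normK K x < R" and l: "Lg K R x > 0" using OmegaR_D[OF x] by auto
  then have "ln (normK K x) = ln R - Lg K R x" by (simp add: Lg_def ln_div)
  then have "- \<gamma> * ln (normK K x) = - \<gamma> * ln R + \<gamma> * Lg K R x"
    by (simp add: right_diff_distrib)
  then have "normK K x powr (- \<gamma>) = R powr (- \<gamma>) * exp (\<gamma> * Lg K R x)"
    using r by (simp only: powr_def exp_add) simp
  then have "1 / normK K x powr \<gamma> = R powr (- \<gamma>) * exp (\<gamma> * Lg K R x)"
    by (simp only: powr_minus_divide)
  moreover have "\<bar>\<gamma> * Lg K R x\<bar> \<le> \<bar>\<gamma>\<bar>" using l L by (simp add: abs_mult mult_left_le)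
  ultimately show "1 / normK K x powr \<gamma> \<le> R powr (- \<gamma>) * exp \<bar>\<gamma>\<bar>"
      "R powr (- \<gamma>) * exp (- \<bar>\<gamma>\<bar>) \<le> 1 / normK K x powr \<gamma>"
    by (auto intro!: mult_left_mono simp: abs_le_iff)
qed

text \<open>The near-optimisers are \<open>L^b\<close> cut off smoothly to \<open>-N < ln L < 0\<close>. The transition layers
  are single shells \<open>-m-1 < ln L \<le> -m\<close>, whose weighted measure is bounded above and below
  independently of \<open>m\<close>, so they cost a bounded amount while the plateau contributes of order \<open>N\<close>.\<close>

lemma log_bump_bounds:
  fixes K :: "'n::finite set" and R p \<alpha> \<beta> :: real
  assumes K: "K \<noteq> {}" and R: "R > 0" and p: "1 < p"
  defines "J \<equiv> \<lambda>f. (\<integral>x. cmod (xgrad K f x) powr p / (normK K x powr (\<alpha> + p) * Lg K R x powr (\<beta> + 1))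
                  \<partial>(lebesgue_on (OmegaR K R)))"
    and "I \<equiv> Ifw K R p (\<alpha> + p) (\<beta> + p + 1)"
  obtains A a where "a > 0" "\<And>N::nat. N \<ge> 2 \<Longrightarrow> \<exists>f. test_fun K R f
      \<and> J f \<le> \<bar>(\<beta> + p) / p\<bar> powr p * I f + A \<and> real (N - 2) * a \<le> I f"
proof -
  obtain d c where d: "\<And>s. (smooth_step has_real_derivative d s) (at s)"
    "\<And>s. s \<le> 0 \<or> s \<ge> 1 \<Longrightarrow> d s = 0" "\<And>s. \<bar>d s\<bar> \<le> c"
    using smooth_step_derivative by metis
  define b where "b = (\<beta> + p) / p"
  define \<gamma> where "\<gamma> = \<alpha> + p"
  let ?\<Omega> = "OmegaR K R"
  let ?M = "lebesgue_on ?\<Omega>"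
  define k where "k = real (card K)"
  define V where "V \<kappa> = measure lebesgue (cyl K \<kappa> R)" for \<kappa>
  \<comment> \<open>The first factor bounds |b phi + phi'|^p, where 2 c accounts for the two smooth
    steps in phi; the second bounds |x'|^(-gamma) for L <= 1.\<close>
  define B where "B = (\<bar>b\<bar> + 2 * c) powr p * (R powr (- \<gamma>) * exp \<bar>\<gamma>\<bar>)"
  define m1 where "m1 = R powr (- \<gamma>) * exp (- \<bar>\<gamma>\<bar>)"
  \<comment> \<open>Lower bound for the mass of one plateau shell. It uses \<open>V 1\<close>
    because the cut-off in x'' equals 1 for |x''|^2 <= 1; \<open>A\<close> uses \<open>V 2\<close>
    because the cut-off vanishes for |x''|^2 >= 2.\<close>
  define a where "a = m1 * (V 1 * exp (- k) * k * (1 - exp (- 1)))"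
  \<comment> \<open>Two transition shells. The factor e remains when 1 / L < e^(m+1) meets a shell
    of measure at most V k e^(-m).\<close>
  define A where "A = 2 * (B * exp 1 * (V 2 * k))"
  have k: "k > 0" using K by (simp add: k_def card_gt_0_iff)
  have c: "c \<ge> 0" using d(3)[of 0] by linarith
  have B: "B \<ge> 0" by (simp add: B_def)
  have m1: "m1 > 0" using R by (simp add: m1_def)
  have "a > 0" unfolding a_def using m1 k measure_cyl_pos[OF R, of 1 K] by (simp add: V_def)
  moreover have "\<exists>f. test_fun K R f \<and> J f \<le> \<bar>b\<bar> powr p * I f + A \<and> real (N - 2) * a \<le> I f"
    if N: "N \<ge> 2" for N :: nat
  proof -
    \<comment> \<open>Equal to 1 on [-(N-1), -1] and to 0 off (-N, 0).\<close>
    define \<phi> where "\<phi> s = smooth_step (s + real N) * smooth_step (- 1 * s)" for s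
    define \<phi>' where "\<phi>' s = d (s + real N) * smooth_step (- s) - d (- s) * smooth_step (s + real N)" for s
    have smooth_\<phi>: "smooth_on UNIV \<phi>" unfolding \<phi>_def[abs_def]
      by (intro smooth_on_mult smooth_on_compose[OF smooth_on_smooth_step]
          smooth_on_add smooth_on_const smooth_on_ident) auto
    have der_\<phi>: "(\<phi> has_real_derivative \<phi>' s) (at s)" for s
    proof -
      have "((\<lambda>s. smooth_step (s + real N)) has_real_derivative d (s + real N) * 1) (at s)"
        by (rule DERIV_chain2[OF d(1)]) (auto intro!: derivative_eq_intros)
      moreover have "((\<lambda>s. smooth_step (- 1 * s)) has_real_derivative d (- 1 * s) * (- 1)) (at s)"
        by (rule DERIV_chain2[OF d(1)]) (auto intro!: derivative_eq_intros)
      ultimately show ?thesis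
        unfolding \<phi>_def[abs_def] \<phi>'_def using DERIV_mult by fastforce
    qed
    have \<phi>_out: "\<phi> s = 0" "\<phi>' s = 0" if "s > 0 \<or> s \<le> - real N" for s
      using that d(2) by (auto simp: \<phi>_def \<phi>'_def smooth_step_eq_0)
    have \<phi>_in: "\<phi> s = 1" "\<phi>' s = 0" if "- (real N - 1) \<le> s" "s \<le> - 1" for s
      using that d(2)[of "s + real N"] d(2)[of "- s"] by (auto simp: \<phi>_def \<phi>'_def smooth_step_eq_1)
    have \<phi>_bound: "\<bar>b * \<phi> s + \<phi>' s\<bar> \<le> \<bar>b\<bar> + 2 * c" for s
    proof -
      have st: "\<bar>smooth_step u\<bar> \<le> 1" for u using smooth_step_bounds[of u] by simp
      have "\<bar>\<phi> s\<bar> \<le> 1 * 1" unfolding \<phi>_def abs_mult by (intro mult_mono st) auto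
      then have "\<bar>b * \<phi> s\<bar> \<le> \<bar>b\<bar>" by (simp add: abs_mult mult_left_le)
      moreover have "\<bar>d u * smooth_step v\<bar> \<le> c" for u v
        using mult_mono[OF d(3)[of u] st[of v] c] by (simp add: abs_mult)
      from this[of "s + real N" "- s"] this[of "- s" "s + real N"]
      have "\<bar>\<phi>' s\<bar> \<le> 2 * c" unfolding \<phi>'_def by linarith
      ultimately show ?thesis by linarith
    qed
    define g where "g t = t powr b * \<phi> (ln t)" for t
    define g' where "g' t = t powr (b - 1) * (b * \<phi> (ln t) + \<phi>' (ln t))" for t
    have g1: "smooth_on {0<..} g" unfolding g_def[abs_def]
      by (intro smooth_on_mult smooth_on_powr smooth_on_compose[OF smooth_\<phi> smooth_on_ln]) auto
    have g2: "(g has_real_derivative g' t) (at t)" if "t > 0" for t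
    proof -
      have "((\<lambda>t. \<phi> (ln t)) has_real_derivative \<phi>' (ln t) * (1 / t)) (at t)"
        by (rule DERIV_chain2[OF der_\<phi>]) (use that in \<open>auto intro!: derivative_eq_intros\<close>)
      from DERIV_mult[OF has_real_derivative_powr[OF that, of b] this]
      show ?thesis using that unfolding g_def[abs_def] g'_def
        by (simp add: powr_diff field_simps)
    qed
    have g3: "exp (- real N) \<le> t \<and> t \<le> exp 0" if "t > 0" "g t \<noteq> 0" for t
    proof -
      have "\<phi> (ln t) \<noteq> 0" using that(2) by (auto simp: g_def)
      then have "- real N \<le> ln t" "ln t \<le> 0" using \<phi>_out(1)[of "ln t"] by linarith+
      then show ?thesis using that(1) by (simp add: ln_ge_iff)
    qed
    have g4: "smooth_on UNIV (\<lambda>z. smooth_step (2 + (- 1) * z))"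
      by (intro smooth_on_compose[OF smooth_on_smooth_step]
          smooth_on_mult smooth_on_add smooth_on_const smooth_on_ident) auto
    have g5: "z \<le> 2" if "smooth_step (2 + (- 1) * z) \<noteq> 0" for z
      using that smooth_step_eq_0[of "2 - z"] by force
    obtain f where f: "test_fun K R f"
      and f_eq: "\<And>x. x \<in> ?\<Omega> \<Longrightarrow> f x = of_real (g (Lg K R x) * smooth_step (2 + (- 1) * (normK (- K) x)\<^sup>2))"
      and xgrad_eq: "\<And>x. x \<in> ?\<Omega> \<Longrightarrow> xgrad K f x = of_real (- (g' (Lg K R x) * smooth_step (2 + (- 1) * (normK (- K) x)\<^sup>2)))"
      using log_radial_test_fun[OF R g1 g2 g3 exp_gt_zero g4 g5, of K] by blast
    define h where "h x = smooth_step (2 + (- 1) * (normK (- K) x)\<^sup>2)" for x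
    define w where "w x = h x powr p / (normK K x powr \<gamma> * Lg K R x)" for x
    define Ji where "Ji x = cmod (xgrad K f x) powr p / (normK K x powr \<gamma> * Lg K R x powr (\<beta> + 1))" for x
    define Ii where "Ii x = cmod (f x) powr p / (normK K x powr \<gamma> * Lg K R x powr (\<beta> + p + 1))" for x
    have h: "0 \<le> h x" "h x \<le> 1" for x using smooth_step_bounds by (auto simp: h_def)
    have Ii: "Ii x = \<bar>\<phi> (ln (Lg K R x))\<bar> powr p * w x" if "x \<in> ?\<Omega>" for x
      unfolding Ii_def f_eq[OF that] h_def[symmetric] g_def b_def w_def
      by (rule log_radial_integrands(1)[OF OmegaR_D(3)[OF that] p h(1)])
    have Ji: "Ji x = \<bar>b * \<phi> (ln (Lg K R x)) + \<phi>' (ln (Lg K R x))\<bar> powr p * w x" if "x \<in> ?\<Omega>" for x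
      unfolding Ji_def xgrad_eq[OF that] h_def[symmetric] g'_def b_def w_def
      by (rule log_radial_integrands(2)[OF OmegaR_D(3)[OF that] p h(1)])
    have intJ: "integrable ?M Ji" unfolding Ji_def
      using p by (intro integrable_weighted_powr[OF f] continuous_on_xgrad_test_fun[OF f] xgrad_outside_support) simp
    have intI: "integrable ?M Ii" unfolding Ii_def
      using p by (intro integrable_weighted_powr[OF f] continuous_on_test_fun[OF f] outside_support) simp
    have J_eq: "J f = integral\<^sup>L ?M Ji" by (simp add: J_def Ji_def[abs_def] \<gamma>_def)
    have I_eq: "I f = integral\<^sup>L ?M Ii" by (simp add: I_def Ifw_def Ii_def[abs_def] \<gamma>_def)
    have w0: "w x \<ge> 0" if "x \<in> ?\<Omega>" for x
      using OmegaR_D[OF that] by (simp add: w_def)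
    \<comment> \<open>Up to the factor B, a majorant of the gradient integrand on the m-th shell:
      e^(m+1) bounds 1 / L there.\<close>
    define E where "E m x = exp (real m + 1) * indicator (shell K R 2 m) x" for m and x :: "real^'n"
    have E0: "E m x \<ge> 0" for m x by (simp add: E_def)
    have Ji_shell: "Ji x \<le> B * E m x"
      if x: "x \<in> ?\<Omega>" and L: "exp (- real m - 1) < Lg K R x" "Lg K R x \<le> exp (- real m)" for x m
    proof (cases "h x = 0")
      case True
      then show ?thesis using x B E0 p by (simp add: Ji w_def)
    next
      case False
      then have "x \<in> shell K R 2 m"
        using x L smooth_step_eq_0[of "2 - (normK (- K) x)\<^sup>2"] by (force simp: shell_def h_def)
      have l: "Lg K R x > 0" using OmegaR_D[OF x] by simp
      have "exp (- real m) \<le> 1" by simp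
      then have L1: "Lg K R x \<le> 1" using L(2) by linarith
      have "h x powr p \<le> 1" using h[of x] p by (simp add: powr_le1)
      then have "w x \<le> 1 / normK K x powr \<gamma> * (1 / Lg K R x)"
        using OmegaR_D[OF x] by (simp add: w_def divide_right_mono)
      also have "\<dots> \<le> (R powr (- \<gamma>) * exp \<bar>\<gamma>\<bar>) * exp (real m + 1)"
      proof (rule mult_mono[OF normK_powr_bounds(1)[OF x L1]])
        have "1 / Lg K R x \<le> 1 / exp (- real m - 1)"
          using L(1) l by (intro divide_left_mono) auto
        also have "\<dots> = exp (real m + 1)" by (simp add: exp_minus[symmetric] divide_inverse)
        finally show "1 / Lg K R x \<le> exp (real m + 1)" .
      qed (use l in auto)
      finally have "w x \<le> (R powr (- \<gamma>) * exp \<bar>\<gamma>\<bar>) * exp (real m + 1)" .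
      moreover have "\<bar>b * \<phi> (ln (Lg K R x)) + \<phi>' (ln (Lg K R x))\<bar> powr p \<le> (\<bar>b\<bar> + 2 * c) powr p"
        using \<phi>_bound p by (intro powr_mono2) auto
      ultimately have "Ji x \<le> (\<bar>b\<bar> + 2 * c) powr p * ((R powr (- \<gamma>) * exp \<bar>\<gamma>\<bar>) * exp (real m + 1))"
        unfolding Ji[OF x] using w0[OF x] by (intro mult_mono) auto
      then show ?thesis using \<open>x \<in> shell K R 2 m\<close> by (simp add: B_def E_def mult_ac)
    qed
    have Ji_le: "Ji x \<le> \<bar>b\<bar> powr p * Ii x + B * (E 0 x + E (N - 1) x)" if x: "x \<in> ?\<Omega>" for x
    proof -
      define s where "s = ln (Lg K R x)"
      have l: "Lg K R x > 0" using OmegaR_D[OF x] by simp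
      then have ls: "Lg K R x = exp s" by (simp add: s_def)
      have nonneg: "0 \<le> \<bar>b\<bar> powr p * Ii x" "0 \<le> B * E 0 x" "0 \<le> B * E (N - 1) x"
        using Ii[OF x] w0[OF x] B E0 by simp_all
      \<comment> \<open>Outside the support; the inner layer, which is shell 0; the outer layer,
        which is shell N - 1; and the plateau, where phi' = 0 and the two integrands differ exactly
        by the factor |b|^p.\<close>
      consider "s > 0 \<or> s \<le> - real N" | "- 1 < s" "s \<le> 0" | "- real N < s" "s \<le> - (real N - 1)"
        | "- (real N - 1) < s" "s \<le> - 1" by linarith
      then show ?thesis
      proof cases
        case 1
        then have "Ji x = 0" using \<phi>_out[of s] p by (simp add: Ji[OF x] s_def[symmetric])
        then show ?thesis using nonneg by (simp add: distrib_left)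
      next
        case 2
        then have "Ji x \<le> B * E 0 x" using ls by (intro Ji_shell x) auto
        then show ?thesis using nonneg by (simp add: distrib_left)
      next
        case 3
        then have "Ji x \<le> B * E (N - 1) x" using ls N by (intro Ji_shell x) (auto simp: of_nat_diff)
        then show ?thesis using nonneg by (simp add: distrib_left)
      next
        case 4
        then have "Ji x = \<bar>b\<bar> powr p * Ii x"
          using \<phi>_in[of s] by (simp add: Ji[OF x] Ii[OF x] s_def[symmetric])
        then show ?thesis using nonneg by (simp add: distrib_left)
      qed
    qed
    have intE: "integrable ?M (E m)" for m
      unfolding E_def by (intro integrable_mult_right integral_indicator_shell R)
    have E_le: "integral\<^sup>L ?M (E m) \<le> exp 1 * (V 2 * k)" for m
    proof -
      have "integral\<^sup>L ?M (E m) = exp (real m + 1) * measure lebesgue (shell K R 2 m)"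
        unfolding E_def by (simp only: integral_mult_right_zero integral_indicator_shell(2)[OF R])
      also have "\<dots> \<le> exp (real m + 1) * (V 2 * k * exp (- real m))"
        using measure_shell_bounds(1)[OF R, of K 2 m] by (intro mult_left_mono) (auto simp: V_def k_def)
      also have "\<dots> = exp 1 * (V 2 * k)"
        by (simp add: exp_add exp_minus)
      finally show ?thesis .
    qed
    have "J f \<le> (\<integral>x. \<bar>b\<bar> powr p * Ii x + B * (E 0 x + E (N - 1) x) \<partial>?M)"
      unfolding J_eq using intJ intI intE Ji_le by (intro integral_mono) auto
    also have "\<dots> = \<bar>b\<bar> powr p * I f + B * (integral\<^sup>L ?M (E 0) + integral\<^sup>L ?M (E (N - 1)))"
      unfolding I_eq using intI intE by simp
    also have "\<dots> \<le> \<bar>b\<bar> powr p * I f + B * (exp 1 * (V 2 * k) + exp 1 * (V 2 * k))"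
      using B E_le by (intro add_left_mono mult_left_mono add_mono) auto
    finally have upper: "J f \<le> \<bar>b\<bar> powr p * I f + A" by (simp add: A_def mult_ac)
    \<comment> \<open>A minorant of the mass on one plateau shell. The shells 1, ..., N - 2 are
      disjoint, so at each point at most one summand is nonzero.\<close>
    define F where "F m x = m1 * exp (real m) * indicator (shell K R 1 m) x" for m and x :: "real^'n"
    have Ii_ge: "(\<Sum>m\<in>{1..<N-1}. F m x) \<le> Ii x" if x: "x \<in> ?\<Omega>" for x
    proof (cases "\<exists>m\<in>{1..<N-1}. x \<in> shell K R 1 m")
      case False
      then have "(\<Sum>m\<in>{1..<N-1}. F m x) = 0" by (intro sum.neutral) (auto simp: F_def)
      then show ?thesis using Ii[OF x] w0[OF x] by simp
    next
      case True
      then obtain m where m: "1 \<le> m" "m < N - 1" and xm: "x \<in> shell K R 1 m" by auto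
      have "(\<Sum>n\<in>{1..<N-1}. F n x) = (\<Sum>n\<in>{1..<N-1}. if n = m then m1 * exp (real m) else 0)"
      proof (rule sum.cong[OF refl])
        fix n
        have "x \<in> shell K R 1 n \<longleftrightarrow> n = m" using disjoint_shells[OF xm] xm by blast
        then show "F n x = (if n = m then m1 * exp (real m) else 0)" by (auto simp: F_def indicator_def)
      qed
      also have "\<dots> = m1 * exp (real m)" using m by simp
      also have "\<dots> \<le> 1 / normK K x powr \<gamma> * (1 / Lg K R x)"
      proof (rule mult_mono)
        have l: "Lg K R x > 0" "Lg K R x \<le> exp (- real m)" using OmegaR_D[OF x] xm by (auto simp: shell_def)
        moreover have "exp (- real m) \<le> 1" by simp
        ultimately have "Lg K R x \<le> 1" by linarith
        then show "m1 \<le> 1 / normK K x powr \<gamma>" unfolding m1_def by (rule normK_powr_bounds(2)[OF x])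
        have "exp (real m) = 1 / exp (- real m)" by (simp add: exp_minus field_simps)
        also have "\<dots> \<le> 1 / Lg K R x" using l by (intro divide_left_mono) auto
        finally show "exp (real m) \<le> 1 / Lg K R x" .
      qed auto
      also have "\<dots> = w x"
      proof -
        have "h x = 1" using xm by (auto simp: h_def shell_def intro!: smooth_step_eq_1)
        then show ?thesis by (simp add: w_def)
      qed
      also have "\<dots> = Ii x"
      proof -
        define s where "s = ln (Lg K R x)"
        have "Lg K R x = exp s" using OmegaR_D[OF x] by (simp add: s_def)
        then have "- real m - 1 < s" "s \<le> - real m" using xm by (auto simp: shell_def)
        moreover have "real m + 1 \<le> real N - 1" "1 \<le> real m" using m by linarith+
        ultimately have "\<phi> s = 1" by (intro \<phi>_in) linarith+
        then show ?thesis by (simp add: Ii[OF x] s_def[symmetric])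
      qed
      finally show ?thesis .
    qed
    have intF: "integrable ?M (F m)" for m
      unfolding F_def by (intro integrable_mult_right integral_indicator_shell R)
    have F_ge: "a \<le> integral\<^sup>L ?M (F m)" for m
    proof -
      have "a = m1 * exp (real m) * (V 1 * exp (- k) * k * (1 - exp (- 1)) * exp (- real m))"
        by (simp add: a_def exp_minus)
      also have "\<dots> \<le> m1 * exp (real m) * measure lebesgue (shell K R 1 m)"
        unfolding V_def k_def using m1 by (intro mult_left_mono measure_shell_bounds(2)[OF R]) auto
      also have "\<dots> = integral\<^sup>L ?M (F m)"
        unfolding F_def by (simp only: integral_mult_right_zero integral_indicator_shell(2)[OF R])
      finally show ?thesis .
    qed
    have "real (N - 2) * a = (\<Sum>m\<in>{1..<N-1}. a)" by (simp add: numeral_2_eq_2)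
    also have "\<dots> \<le> (\<Sum>m\<in>{1..<N-1}. integral\<^sup>L ?M (F m))" by (intro sum_mono F_ge)
    also have "\<dots> = (\<integral>x. (\<Sum>m\<in>{1..<N-1}. F m x) \<partial>?M)"
      using intF by (simp add: Bochner_Integration.integral_sum)
    also have "\<dots> \<le> I f"
      unfolding I_eq using intI intF Ii_ge by (intro integral_mono) auto
    finally show ?thesis using f upper by blast
  qed
  ultimately show thesis unfolding b_def by (rule that)
qed

lemma hardy_sharp:
  fixes K :: "'n::finite set" and R p \<alpha> \<beta> :: real
  assumes K: "K \<noteq> {}" and R: "R > 0" and p: "1 < p" and C: "C > \<bar>(\<beta> + p) / p\<bar> powr p"
  shows "\<exists>f. test_fun K R f \<and>
      (\<integral>x. cmod (xgrad K f x) powr p / (normK K x powr (\<alpha> + p) * Lg K R x powr (\<beta> + 1))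
          \<partial>(lebesgue_on (OmegaR K R))) < C * Ifw K R p (\<alpha> + p) (\<beta> + p + 1) f"
proof -
  define \<epsilon> where "\<epsilon> = C - \<bar>(\<beta> + p) / p\<bar> powr p"
  have \<epsilon>: "\<epsilon> > 0" using C by (simp add: \<epsilon>_def)
  let ?J = "\<lambda>f. (\<integral>x. cmod (xgrad K f x) powr p / (normK K x powr (\<alpha> + p) * Lg K R x powr (\<beta> + 1))
                  \<partial>(lebesgue_on (OmegaR K R)))"
  let ?I = "Ifw K R p (\<alpha> + p) (\<beta> + p + 1)"
  obtain a A where a: "a > 0" and *: "\<And>N::nat. N \<ge> 2 \<Longrightarrow> \<exists>f. test_fun K R f
      \<and> ?J f \<le> \<bar>(\<beta> + p) / p\<bar> powr p * ?I f + A \<and> real (N - 2) * a \<le> ?I f"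
    by (rule log_bump_bounds[OF K R p, where \<alpha> = \<alpha> and \<beta> = \<beta>]) (rule that)
  \<comment> \<open>With n plateau shells the surplus \<open>\<epsilon> * ?I f\<close> is at least
    epsilon n a, which this choice puts above the fixed cost A.\<close>
  obtain n :: nat where n: "A / (\<epsilon> * a) < real n" using reals_Archimedean2 by blast
  obtain f where f: "test_fun K R f" "?J f \<le> \<bar>(\<beta> + p) / p\<bar> powr p * ?I f + A" "real n * a \<le> ?I f"
    using *[of "n + 2"] by auto
  have "A < \<epsilon> * (real n * a)" using n \<epsilon> a by (simp add: pos_divide_less_eq mult_ac)
  also have "\<dots> \<le> \<epsilon> * ?I f" using f(3) \<epsilon> by simp
  also have "\<dots> = C * ?I f - \<bar>(\<beta> + p) / p\<bar> powr p * ?I f" by (simp add: \<epsilon>_def left_diff_distrib)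
  finally show ?thesis using f by (intro exI[of _ f]) linarith
qed

theorem theorem4p1:
  fixes K :: "'n::finite set" and R p \<alpha> \<beta> :: real
  assumes "K \<noteq> {}" and "R > 0" and "1 < p"
  defines "k \<equiv> real (card K)"
  shows
    "((k - \<alpha> - p) * (\<beta> + p) \<ge> 0 \<longrightarrow>
        (\<forall>f. test_fun K R f \<longrightarrow>
           \<bar>(\<beta> + p) / p\<bar> powr p * Ifw K R p (\<alpha> + p) (\<beta> + p + 1) f
             \<le> (\<integral>x. cmod (xgrad K f x) powr p / (normK K x powr (\<alpha> + p) * Lg K R x powr (\<beta> + 1))
                  \<partial>(lebesgue_on (OmegaR K R))))
      \<and> (\<beta> \<noteq> - p \<longrightarrow> (\<forall>C. C > \<bar>(\<beta> + p) / p\<bar> powr p \<longrightarrow>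
           (\<exists>f. test_fun K R f \<and>
              C * Ifw K R p (\<alpha> + p) (\<beta> + p + 1) f
             > (\<integral>x. cmod (xgrad K f x) powr p / (normK K x powr (\<alpha> + p) * Lg K R x powr (\<beta> + 1))
                  \<partial>(lebesgue_on (OmegaR K R)))))))
   \<and> (\<forall>f. test_fun K R f \<longrightarrow>
        \<bar>(\<beta> + p) / p\<bar> powr p * Ifw K R p (\<alpha> + p) (\<beta> + p + 1) f
        = (\<integral>x. cmod (xgrad K f x) powr p / (normK K x powr (\<alpha> + p) * Lg K R x powr (\<beta> + 1))
              \<partial>(lebesgue_on (OmegaR K R)))
          - (k - \<alpha> - p) * ((\<beta> + p) / p) * \<bar>(\<beta> + p) / p\<bar> powr (p - 2)
              * Ifw K R p (\<alpha> + p) (\<beta> + p) f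
          - (\<integral>x. Cp p (xi_fun K R p \<alpha> \<beta> f x) (eta_fun K R p \<alpha> \<beta> f x)
              \<partial>(lebesgue_on (OmegaR K R))))
   \<and> (k = \<alpha> + p \<and> p \<ge> 2 \<longrightarrow>
        (\<forall>f. test_fun K R f \<longrightarrow>
           ((\<integral>x. Cp p (xi_fun K R p \<alpha> \<beta> f x) (eta_fun K R p \<alpha> \<beta> f x)
               \<partial>(lebesgue_on (OmegaR K R))) = 0 \<longrightarrow>
              (\<exists>\<phi> :: real^'n \<Rightarrow> complex. \<forall>x\<in>OmegaR K R.
                  f x = complex_of_real (Lg K R x powr ((\<beta> + p) / p))
                        * \<phi> (\<chi> i. if i \<in> K then x$i / normK K x else x$i))
              \<and> (\<forall>x. f x = 0))
           \<and> ((\<exists>x. f x \<noteq> 0) \<longrightarrow>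
                \<bar>(\<beta> + p) / p\<bar> powr p * Ifw K R p (\<alpha> + p) (\<beta> + p + 1) f
                < (\<integral>x. cmod (xgrad K f x) powr p / (normK K x powr (\<alpha> + p) * Lg K R x powr (\<beta> + 1))
                     \<partial>(lebesgue_on (OmegaR K R))))))"
proof -
  let ?J = "\<lambda>f. \<integral>x. cmod (xgrad K f x) powr p / (normK K x powr (\<alpha> + p) * Lg K R x powr (\<beta> + 1))
                  \<partial>(lebesgue_on (OmegaR K R))"
  let ?I = "Ifw K R p (\<alpha> + p) (\<beta> + p + 1)"
  let ?C = "\<lambda>f. \<integral>x. Cp p (xi_fun K R p \<alpha> \<beta> f x) (eta_fun K R p \<alpha> \<beta> f x) \<partial>(lebesgue_on (OmegaR K R))"
  have ineq: "\<bar>(\<beta> + p) / p\<bar> powr p * ?I f \<le> ?J f"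
    if "(k - \<alpha> - p) * (\<beta> + p) \<ge> 0" "test_fun K R f" for f
    using hardy_inequality[OF that(2) assms(3)] that(1) by (simp only: k_def)
  have sharp: "\<exists>f. test_fun K R f \<and> ?J f < C * ?I f" if "C > \<bar>(\<beta> + p) / p\<bar> powr p" for C
    by (rule hardy_sharp[OF assms(1-3) that])
  have ident: "\<bar>(\<beta> + p) / p\<bar> powr p * ?I f = ?J f
      - (k - \<alpha> - p) * ((\<beta> + p) / p) * \<bar>(\<beta> + p) / p\<bar> powr (p - 2) * Ifw K R p (\<alpha> + p) (\<beta> + p) f - ?C f"
    if "test_fun K R f" for f
    unfolding k_def by (rule hardy_identity[OF that assms(3)])
  have zero: "f x = 0" if "test_fun K R f" "?C f = 0" for f x
    by (rule integral_Cp_eq_0_imp[OF that(1) assms(3) that(2)])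
  \<comment> \<open>For k = alpha + p the lower-order term disappears and the deficit is precisely
    the integral of \<open>Cp\<close>, which cannot vanish for nonzero f.\<close>
  have strict: "\<bar>(\<beta> + p) / p\<bar> powr p * ?I f < ?J f" if "k = \<alpha> + p" "test_fun K R f" "f x \<noteq> 0" for f x
  proof -
    have "0 \<le> ?C f" by (intro Bochner_Integration.integral_nonneg Cp_nonneg assms(3))
    moreover have "?C f \<noteq> 0" using zero[OF that(2)] that(3) by blast
    moreover have "\<bar>(\<beta> + p) / p\<bar> powr p * ?I f = ?J f - ?C f" using ident[OF that(2)] that(1) by simp
    ultimately show ?thesis by linarith
  qed
  \<comment> \<open>Vanishing of the integral already forces f = 0, so the zero function serves as
    the angular profile.\<close>
  have form: "\<exists>\<phi> :: real^'n \<Rightarrow> complex. \<forall>x\<in>OmegaR K R.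
      f x = complex_of_real (Lg K R x powr ((\<beta> + p) / p)) * \<phi> (\<chi> i. if i \<in> K then x$i / normK K x else x$i)"
    if "test_fun K R f" "?C f = 0" for f
    using zero[OF that] by (intro exI[of _ "\<lambda>_. 0"]) simp
  show ?thesis
    apply (intro conjI impI allI)
    subgoal by (rule ineq)
    subgoal by (rule sharp)
    subgoal by (rule ident)
    subgoal by (rule form)
    subgoal by (rule zero)
    subgoal using strict by blast
    done
qed

end
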